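(* Let $n$ be a positive integer. The alternating group $A_n$ is uniformly semi-rational if and only if $n<23$ and $n\notin\{16,21\}$.
   Context: Let $G$ be a finite group and $r$ an integer. An element $x\in G$ is called $r$-semi-rational in $G$ if every generator of the cyclic subgroup $\langle x\rangle$ is conjugate in $G$ either to $x$ or to $x^{r}$. The group $G$ is $r$-semi-rational if every element of $G$ is $r$-semi-rational (for the same integer $r$), and $G$ is uniformly semi-rational if there exists an integer $r$ such that $G$ is $r$-semi-rational. *)

theory Defs
  imports "HOL-Algebra.Algebra"
begin

definition conjugate_in :: "('a, 'b) monoid_scheme \<Rightarrow> 'a \<Rightarrow> 'a \<Rightarrow> bool" where
  "conjugate_in G x y \<longleftrightarrow>
     (\<exists>g \<in> carrier G. y = g \<otimes>\<^bsub>G\<^esub> x \<otimes>\<^bsub>G\<^esub> inv\<^bsub>G\<^esub> g)"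

definition semi_rational_element :: "('a, 'b) monoid_scheme \<Rightarrow> int \<Rightarrow> 'a \<Rightarrow> bool" where
  "semi_rational_element G r x \<longleftrightarrow>
     (\<forall>y \<in> generate G {x}. generate G {y} = generate G {x} \<longrightarrow>
        conjugate_in G y x \<or> conjugate_in G y (x [^]\<^bsub>G\<^esub> r))"

definition semi_rational_group :: "('a, 'b) monoid_scheme \<Rightarrow> int \<Rightarrow> bool" where
  "semi_rational_group G r \<longleftrightarrow>
     group G \<and> finite (carrier G) \<and> (\<forall>x \<in> carrier G. semi_rational_element G r x)"

definition uniformly_semi_rational :: "('a, 'b) monoid_scheme \<Rightarrow> bool" where
  "uniformly_semi_rational G \<longleftrightarrow> (\<exists>r. semi_rational_group G r)"

end

theory Submission
  imports Defs "HOL-Number_Theory.Cong"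
begin

text \<open>
  A generator \<open>x\<^sup>k\<close> of the group generated by \<open>x\<close> is conjugate to \<open>x\<close> in the symmetric group, by
  multiplication by \<open>k\<close> on each cycle. If some odd permutation commutes with \<open>x\<close>, the conjugating
  permutation can be made even. Otherwise the cycle lengths form a partition \<open>L\<close> of \<open>n\<close> into
  distinct odd parts, the centraliser of \<open>x\<close> consists of even permutations, and the sign of the
  conjugating permutation is the Jacobi symbol of \<open>k\<close> modulo the product of \<open>L\<close> (Zolotarev's lemma,
  used here as the definition of the symbol). So \<open>r\<close> works for \<open>A\<^sub>n\<close> iff the symbol of \<open>r\<close> is -1 for
  every \<open>L\<close> whose symbol is nontrivial. Three partitions with nontrivial symbols whose products
  multiply to a square rule this out. For almost all \<open>n\<close> they are the unions of two among three
  disjoint sets of odd numbers with equal sums and with products distinct modulo 8, so that the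
  values of the symbol at -1 and 2 show nontriviality.
\<close>

section \<open>Signs of permutations of finite sets\<close>

lemma sign_transport:
  assumes "finite A" "p permutes A" "inj_on f A" "q permutes f ` A"
    and "\<And>x. x \<in> A \<Longrightarrow> q (f x) = f (p x)"
  shows "sign q = sign p"
proof -
  \<comment> \<open>Intertwining along \<open>f\<close> determines \<open>q\<close> on the image of
    \<open>A\<close>, and both sides fix everything else; so \<open>q\<close> is \<open>p\<close>
    with its points renamed, possibly in another type.\<close>
  have "q = map_permutation A f p"
  proof
    fix y
    show "q y = map_permutation A f p y"
      using assms map_permutation_apply[OF assms(3)] permutes_not_in[OF assms(4)]
      by (cases "y \<in> f ` A") (auto simp: map_permutation_def)
  qed
  then show ?thesis
    using sign_map_permutation assms by blast
qed

lemma sign_mult_permutes: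
  assumes "finite S" "p permutes S" "q permutes S"
  shows "sign (p \<circ> q) = sign p * sign q"
  by (rule sign_compose) (rule permutes_imp_permutation[OF assms(1)], rule assms)+

lemma sign_funpow:
  assumes "finite S" "p permutes S"
  shows "sign (p ^^ k) = sign p ^ k"
proof (induction k)
  case (Suc k)
  then show ?case
    using sign_mult_permutes[OF assms permutes_funpow[OF assms(2), of k]]
    by (simp only: funpow.simps power_Suc)
qed simp

lemma sign_odd_order:
  assumes "finite S" "p permutes S" "p ^^ k = id" "odd k"
  shows "sign p = 1"
proof -
  have "sign p ^ k = 1" using sign_funpow[OF assms(1,2), of k] assms(3) by simp
  then show ?thesis using \<open>odd k\<close> by (cases p rule: sign_cases) auto
qed

lemma permutes_of_inj:
  assumes "finite S" "inj_on p S" "\<And>x. x \<in> S \<Longrightarrow> p x \<in> S" "\<And>x. x \<notin> S \<Longrightarrow> p x = x"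
  shows "p permutes S"
proof (rule bij_imp_permutes)
  have "p ` S \<subseteq> S" using assms(3) by blast
  then show "bij_betw p S S"
    using assms(1,2) endo_inj_surj[of S p] by (simp add: bij_betw_def)
qed (rule assms(4))

lemma mod_sub: "m \<le> n \<Longrightarrow> n < 2 * m \<Longrightarrow> n mod m = n - m" for m n :: nat
  by (simp add: le_mod_geq)

subsection \<open>Rotations\<close>

definition rotmap :: "nat \<Rightarrow> nat \<Rightarrow> nat" where
  "rotmap m i = (if i < m then Suc i mod m else i)"

lemma funpow_rotmap: "i < m \<Longrightarrow> (rotmap m ^^ k) i = (i + k) mod m"
  by (induction k) (auto simp: rotmap_def mod_Suc_eq)

lemma funpow_rotmap_out: "\<not> i < m \<Longrightarrow> (rotmap m ^^ k) i = i"
  by (induction k) (auto simp: rotmap_def)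

lemma rotmap_permutes: "rotmap m permutes {..<m}"
proof (rule permutes_of_inj)
  show "inj_on (rotmap m) {..<m}"
    by (auto simp: inj_on_def rotmap_def mod_Suc split: if_splits)
qed (auto simp: rotmap_def)

lemma rotmap_period: "rotmap m ^^ m = id"
  by (rule ext) (metis funpow_rotmap funpow_rotmap_out id_apply mod_add_self2 mod_less)

text \<open>Each induction step splits off one transposition: exchanging 0 and \<open>Suc l\<close>
  after the shorter cycle inserts the new point \<open>Suc l\<close> between \<open>l\<close> and
  0.\<close>

lemma sign_rotmap: "sign (rotmap (Suc l)) = (-1) ^ l"
proof (induction l)
  case 0
  have "rotmap (Suc 0) = id" by (auto simp: rotmap_def)
  then show ?case by simp
next
  case (Suc l)
  have "rotmap (Suc (Suc l)) = transpose 0 (Suc l) \<circ> rotmap (Suc l)"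
    by (auto simp: fun_eq_iff rotmap_def transpose_def mod_Suc)
  moreover have "sign (transpose 0 (Suc l) \<circ> rotmap (Suc l)) = sign (transpose 0 (Suc l)) * sign (rotmap (Suc l))"
    by (rule sign_compose) (auto simp: permutation_swap_id intro: permutes_imp_permutation[OF _ rotmap_permutes])
  ultimately show ?case using Suc by (metis (lifting) Zero_not_Suc mult_minus1 power_Suc sign_swap_id)
qed

subsection \<open>The Zolotarev symbol\<close>

text \<open>Being the identity from \<open>m\<close> on, the map permutes all naturals when
  \<open>j\<close> is coprime to \<open>m\<close>, so that its sign makes sense. Otherwise
  \<open>sign\<close> still returns 1 or -1, without meaning.\<close>

definition mulmap :: "nat \<Rightarrow> nat \<Rightarrow> nat \<Rightarrow> nat" where
  "mulmap m j i = (if i < m then j * i mod m else i)"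

definition zol :: "nat \<Rightarrow> nat \<Rightarrow> int" where
  "zol m j = sign (mulmap m j)"

lemma mulmap_permutes:
  assumes "coprime j m"
  shows "mulmap m j permutes {..<m}"
proof (rule permutes_of_inj)
  show "inj_on (mulmap m j) {..<m}"
  proof (rule inj_onI)
    fix a b assume *: "a \<in> {..<m}" "b \<in> {..<m}" "mulmap m j a = mulmap m j b"
    then have "[j * a = j * b] (mod m)" by (auto simp: mulmap_def cong_def)
    then have "[a = b] (mod m)" using assms cong_mult_lcancel_nat by blast
    then show "a = b" using * by (auto simp: cong_def)
  qed
qed (auto simp: mulmap_def)

lemma zol_cong: "[j = k] (mod m) \<Longrightarrow> zol m j = zol m k"
proof -
  assume "[j = k] (mod m)"
  then have "mulmap m j = mulmap m k"
    by (auto simp: mulmap_def fun_eq_iff cong_def intro: mod_mult_cong)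
  then show ?thesis by (simp add: zol_def)
qed

lemma zol_one_right [simp]: "zol m (Suc 0) = 1"
proof -
  have "mulmap m (Suc 0) = id" by (auto simp: mulmap_def)
  then show ?thesis by (simp add: zol_def)
qed

lemma zol_one_left [simp]: "zol (Suc 0) j = 1"
proof -
  have "mulmap (Suc 0) j = id" by (auto simp: mulmap_def)
  then show ?thesis by (simp add: zol_def)
qed

lemma zol_square [simp]: "zol m j * zol m j = 1"
  by (simp add: zol_def)

text \<open>Modulo \<open>2 * h + 1\<close> this is negation, which fixes 0 and otherwise consists
  of \<open>h\<close> disjoint transpositions.\<close>

lemma zol_minus_one: "zol (Suc (2 * h)) (2 * h) = (-1) ^ h"
proof -
  define m where "m = Suc (2 * h)"
  \<comment> \<open>\<open>f k\<close> performs only the \<open>k\<close> outermost exchanges of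
    \<open>i\<close> and \<open>m - i\<close>, so that each induction step adds one
    transposition.\<close>
  define f where "f k i = (if 1 \<le> i \<and> i \<le> k \<or> m - k \<le> i \<and> i < m then m - i else i)" for k i
  have "permutation (f k) \<and> sign (f k) = (-1) ^ k" if "k \<le> h" for k
    using that
  proof (induction k)
    case 0
    have "f 0 = id" by (auto simp: f_def)
    then show ?case by simp
  next
    case (Suc k)
    have "f (Suc k) = transpose (Suc k) (m - Suc k) \<circ> f k"
      using Suc.prems by (auto simp: fun_eq_iff f_def transpose_def m_def)
    moreover have "Suc k \<noteq> m - Suc k" using Suc.prems by (auto simp: m_def)
    moreover have "permutation (f k)" "sign (f k) = (-1) ^ k" using Suc by auto
    ultimately show ?case
      by (metis (lifting) sign_compose permutation_compose permutation_swap_id sign_swap_id power_Suc)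
  qed
  moreover have "mulmap m (2 * h) = f h"
  proof
    fix i
    show "mulmap m (2 * h) i = f h i"
    proof (cases "0 < i \<and> i < m")
      case True
      \<comment> \<open>Division with quotient \<open>i - 1\<close> and remainder
        \<open>m - i\<close>, which represents the negative of \<open>i\<close> modulo
        \<open>m\<close>.\<close>
      then have "2 * h * i = (i - 1) * m + (m - i)"
        by (cases i) (auto simp: m_def algebra_simps)
      then have "2 * h * i mod m = m - i"
        using True by (simp only: mod_mult_self3) auto
      then show ?thesis using True by (auto simp: mulmap_def f_def m_def)
    next
      case False
      then show ?thesis by (auto simp: mulmap_def f_def m_def)
    qed
  qed
  ultimately show ?thesis by (simp add: zol_def m_def)
qed

text \<open>The exponent is h(h+1)/2 = (m^2-1)/8 for m = 2h+1, as in the supplementary law for 2.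
  The induction compares doubling modulo 2h+3 with doubling modulo 2h+1: they differ by a cycle of
  length h+2.\<close>

lemma zol_two: "zol (Suc (2 * h)) 2 = (-1) ^ (\<Sum>i\<le>h. i)"
proof (induction h)
  case 0
  then show ?case by simp
next
  case (Suc h)
  define A where "A = (+) (Suc h) ` {..<Suc (Suc h)}"
  \<comment> \<open>The cycle in question; it runs through the numbers from \<open>Suc h\<close> to
    \<open>2 * Suc h\<close>.\<close>
  define r where "r i = (if i \<in> A then Suc h + rotmap (Suc (Suc h)) (i - Suc h) else i)" for i
  have A: "A = {Suc h..2 * Suc h}"
    unfolding A_def lessThan_atLeast0 image_add_atLeastLessThan by auto
  have r: "r permutes A"
  proof (rule permutes_of_inj)
    show "inj_on r A"
    proof (rule inj_onI)
      fix x y assume "x \<in> A" "y \<in> A" "r x = r y"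
      then have "x - Suc h = y - Suc h"
        using permutes_inj[OF rotmap_permutes[of "Suc (Suc h)"]] by (auto simp: r_def inj_def)
      then show "x = y" using \<open>x \<in> A\<close> \<open>y \<in> A\<close> by (auto simp: A)
    qed
  qed (use permutes_in_image[OF rotmap_permutes[of "Suc (Suc h)"]] in \<open>auto simp: r_def A_def\<close>)
  have "sign r = sign (rotmap (Suc (Suc h)))"
    by (rule sign_transport[where A = "{..<Suc (Suc h)}" and f = "(+) (Suc h)"])
      (use rotmap_permutes r in \<open>auto simp: r_def A_def\<close>)
  then have sr: "sign r = (-1) ^ Suc h" by (simp only: sign_rotmap)
  \<comment> \<open>Below \<open>Suc h\<close> doubling wraps for neither modulus. From there to
    \<open>2 * h\<close> it wraps for both, and the shift by \<open>r\<close> makes up for the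
    larger modulus. The last two points of the cycle are fixed by the right-hand side.\<close>
  have "mulmap (Suc (2 * Suc h)) 2 \<circ> r = mulmap (Suc (2 * h)) 2"
  proof
    fix i
    consider "i < Suc h" | "Suc h \<le> i" "i \<le> 2 * h" | "i = Suc (2 * h)" | "i = 2 * Suc h" | "2 * Suc h < i"
      by atomize_elim arith
    then show "(mulmap (Suc (2 * Suc h)) 2 \<circ> r) i = mulmap (Suc (2 * h)) 2 i"
    proof cases
      case 1
      then have "r i = i" by (simp add: r_def A)
      with 1 show ?thesis by (simp add: mulmap_def)
    next
      case 2
      then have "r i = Suc i" by (simp add: r_def A rotmap_def)
      moreover have "2 * Suc i mod Suc (2 * Suc h) = 2 * i - Suc (2 * h)"
        using 2 by (subst mod_sub) auto
      moreover have "2 * i mod Suc (2 * h) = 2 * i - Suc (2 * h)"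
        using 2 by (subst mod_sub) auto
      moreover have "i < 2 * Suc h" using 2 by simp
      ultimately show ?thesis using 2 by (simp add: mulmap_def del: mult_Suc_right)
    next
      case 3
      then have "r i = Suc i" by (simp add: r_def A rotmap_def)
      moreover have "(2 * Suc i) mod Suc (2 * Suc h) = 2 * Suc i - Suc (2 * Suc h)"
        by (rule mod_sub) (simp_all add: 3)
      moreover have "2 * Suc i - Suc (2 * Suc h) = i" using 3 by simp
      moreover have "Suc i < Suc (2 * Suc h)" "\<not> i < Suc (2 * h)" using 3 by simp_all
      ultimately show ?thesis by (simp only: mulmap_def comp_def if_True if_False)
    next
      case 4
      then have "r i = Suc h" by (simp add: r_def A rotmap_def)
      moreover have "2 * Suc h mod Suc (2 * Suc h) = 2 * Suc h" by (rule mod_less) simp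
      moreover have "Suc h < Suc (2 * Suc h)" "\<not> i < Suc (2 * h)" using 4 by simp_all
      ultimately show ?thesis unfolding 4 by (simp only: mulmap_def comp_def if_True if_False)
    next
      case 5
      then have "r i = i" by (simp add: r_def A)
      moreover have "\<not> i < Suc (2 * Suc h)" "\<not> i < Suc (2 * h)" using 5 by simp_all
      ultimately show ?thesis by (simp only: mulmap_def comp_def if_False)
    qed
  qed
  then have "sign (mulmap (Suc (2 * Suc h)) 2 \<circ> r) = zol (Suc (2 * h)) 2"
    by (simp add: zol_def)
  moreover have "sign (mulmap (Suc (2 * Suc h)) 2 \<circ> r) = sign (mulmap (Suc (2 * Suc h)) 2) * sign r"
  proof (rule sign_compose)
    have "coprime 2 (Suc (2 * Suc h))" by simp
    then show "permutation (mulmap (Suc (2 * Suc h)) 2)"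
      using permutes_imp_permutation[OF _ mulmap_permutes] by blast
    show "permutation r"
      using permutes_imp_permutation[OF _ r] by (simp add: A)
  qed
  ultimately have "zol (Suc (2 * h)) 2 = zol (Suc (2 * Suc h)) 2 * (-1) ^ Suc h"
    by (simp only: zol_def sr)
  then have "zol (Suc (2 * Suc h)) 2 = zol (Suc (2 * h)) 2 * (-1) ^ Suc h"
    by (cases "even h") auto
  then show ?case
    by (simp only: Suc sum.atMost_Suc power_add)
qed

section \<open>Disjoint sums of permutations, and multiplicativity of the symbol in the
  modulus\<close>

definition block :: "'i set \<Rightarrow> ('i \<Rightarrow> nat \<Rightarrow> nat) \<Rightarrow> 'i \<times> nat \<Rightarrow> 'i \<times> nat" where
  "block I f = (\<lambda>(a, i). if a \<in> I then (a, f a i) else (a, i))"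

lemma block_permutes:
  assumes "\<And>a. a \<in> I \<Longrightarrow> f a permutes {..<len a}"
  shows "block I f permutes (SIGMA a:I. {..<len a})"
proof (rule bij_imp_permutes)
  show "bij_betw (block I f) (SIGMA a:I. {..<len a}) (SIGMA a:I. {..<len a})"
    unfolding bij_betw_def
  proof
    show "inj_on (block I f) (SIGMA a:I. {..<len a})"
    proof (rule inj_onI)
      fix v w assume *: "v \<in> (SIGMA a:I. {..<len a})" "w \<in> (SIGMA a:I. {..<len a})"
        "block I f v = block I f w"
      obtain a i b k where vw: "v = (a, i)" "w = (b, k)" by (metis surj_pair)
      then have "a \<in> I" "a = b" "f a i = f a k" using * by (auto simp: block_def)
      then show "v = w" using vw inj_eq[OF permutes_inj[OF assms]] by blast
    qed
    show "block I f ` (SIGMA a:I. {..<len a}) = (SIGMA a:I. {..<len a})"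
    proof (intro equalityI subsetI)
      fix w assume "w \<in> (SIGMA a:I. {..<len a})"
      then obtain a i where w: "w = (a, i)" "a \<in> I" "i < len a" by auto
      then have "i \<in> f a ` {..<len a}" using permutes_image[OF assms] by auto
      then obtain k where "k < len a" "i = f a k" by auto
      then have "w = block I f (a, k)" "(a, k) \<in> (SIGMA a:I. {..<len a})"
        using w by (auto simp: block_def)
      then show "w \<in> block I f ` (SIGMA a:I. {..<len a})" by blast
    next
      fix w assume "w \<in> block I f ` (SIGMA a:I. {..<len a})"
      then obtain a i where "w = (a, f a i)" "a \<in> I" "i < len a" by (auto simp: block_def)
      then show "w \<in> (SIGMA a:I. {..<len a})"
        using permutes_in_image[OF assms, of a i] by simp
    qed
  qed
  show "block I f w = w" if "w \<notin> (SIGMA a:I. {..<len a})" for w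
  proof (cases w)
    case (Pair a i)
    then show ?thesis
      using that permutes_not_in[OF assms, of a i] by (auto simp: block_def)
  qed
qed

text \<open>The sum is the composition of its summands, each of which moves only its own copy of an
  initial segment and has there the sign of \<open>f a\<close>.\<close>

lemma sign_block:
  assumes "finite I" "\<And>a. a \<in> I \<Longrightarrow> f a permutes {..<len a}"
  shows "sign (block I f) = (\<Prod>a\<in>I. sign (f a))"
  using assms
proof (induction I)
  case empty
  have "block {} f = id" by (auto simp: block_def)
  then show ?case by simp
next
  case (insert a I)
  have "block {a} f permutes (SIGMA b:{a}. {..<len b})"
    by (rule block_permutes) (use insert.prems in auto)
  moreover have "(SIGMA b:{a}. {..<len b}) = Pair a ` {..<len a}" by auto
  ultimately have p1: "block {a} f permutes Pair a ` {..<len a}" by simp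
  have p2: "block I f permutes (SIGMA b:I. {..<len b})"
    by (rule block_permutes) (use insert.prems in auto)
  have "sign (block {a} f) = sign (f a)"
    by (rule sign_transport[OF _ _ _ p1]) (use insert.prems in \<open>auto simp: block_def inj_on_def\<close>)
  moreover have "block (insert a I) f = block {a} f \<circ> block I f"
    using insert.hyps by (auto simp: block_def fun_eq_iff)
  moreover have "sign (block {a} f \<circ> block I f) = sign (block {a} f) * sign (block I f)"
    by (rule sign_compose)
      (use insert.hyps permutes_imp_permutation[OF _ p1] permutes_imp_permutation[OF _ p2] in auto)
  moreover have "sign (block I f) = (\<Prod>a\<in>I. sign (f a))"
    using insert by blast
  ultimately show ?case using insert.hyps by (simp only: prod.insert[OF insert.hyps(1,2)])
qed

lemma sign_power_odd: "odd k \<Longrightarrow> sign p ^ k = sign p"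
  by (cases p rule: sign_cases) simp_all

text \<open>Write a residue as \<open>q * a + s\<close> with digits \<open>s < a\<close> and
  \<open>q < b\<close>. Multiplication by \<open>j\<close> first multiplies \<open>q\<close> by
  \<open>j\<close> (\<open>P1\<close>), then adds the carry \<open>j * s div a\<close> to it
  (\<open>P2\<close>), then multiplies \<open>s\<close> by \<open>j\<close> (\<open>P3\<close>).
  \<open>P1\<close> and \<open>P3\<close> consist of \<open>a\<close> and \<open>b\<close> copies,
  odd numbers, so their signs are the two symbols. The factors may share divisors, so squares are
  covered.\<close>

lemma zol_mult_left:
  assumes "odd a" "odd b" "coprime j (a * b)"
  shows "zol (a * b) j = zol a j * zol b j"
proof -
  have a0: "a > 0" "b > 0" using assms odd_pos by auto
  have cop: "coprime j a" "coprime j b" using assms(3) by auto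
  define A where "A = (SIGMA s:{..<a}. {..<b})"
  define e where "e = (\<lambda>(s, q). q * a + s)"
  define P1 where "P1 = block {..<a} (\<lambda>s. mulmap b j)"
  define P2 where "P2 = block {..<a} (\<lambda>s. rotmap b ^^ (j * s div a))"
  define P where "P = block {..<b} (\<lambda>q. mulmap a j)"
  \<comment> \<open>\<open>block\<close> acts on second coordinates, so the action on the low digit
    is set up on swapped pairs.\<close>
  define P3 where "P3 = prod.swap \<circ> P \<circ> prod.swap"
  have e_inj: "inj_on e A"
  proof (rule inj_onI)
    fix x y assume *: "x \<in> A" "y \<in> A" "e x = e y"
    obtain s q s' q' where xy: "x = (s, q)" "y = (s', q')" by fastforce
    then have "(q * a + s) div a = (q' * a + s') div a" "(q * a + s) mod a = (q' * a + s') mod a"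
      using * by (auto simp: e_def)
    then show "x = y" using * a0 xy by (auto simp: A_def)
  qed
  have e_im: "e ` A = {..<a * b}"
  proof (rule card_subset_eq)
    show "e ` A \<subseteq> {..<a * b}"
    proof (clarsimp simp: A_def e_def)
      fix s q assume "s < a" "q < b"
      then have "q * a + s < Suc q * a" "Suc q * a \<le> b * a"
        using mult_le_mono1[of "Suc q" b a] by auto
      then show "q * a + s < a * b" by (simp add: mult.commute)
    qed
    show "card (e ` A) = card {..<a * b}"
      using card_image[OF e_inj] by (simp add: A_def)
  qed auto
  have P1: "P1 permutes A" unfolding P1_def A_def
    by (rule block_permutes) (rule mulmap_permutes[OF cop(2)])
  have P2: "P2 permutes A" unfolding P2_def A_def
    by (rule block_permutes) (rule permutes_funpow[OF rotmap_permutes])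
  have P: "P permutes {..<b} \<times> {..<a}" unfolding P_def
    by (rule block_permutes) (rule mulmap_permutes[OF cop(1)])
  have im: "prod.swap ` ({..<b} \<times> {..<a}) = A" by (auto simp: A_def image_iff)
  have P3: "P3 permutes A"
    unfolding permutes_def
  proof (intro conjI allI impI)
    fix x assume "x \<notin> A"
    then have "prod.swap x \<notin> {..<b} \<times> {..<a}" by (cases x) (auto simp: A_def)
    then show "P3 x = x" using permutes_not_in[OF P] by (simp add: P3_def)
  next
    fix y
    show "\<exists>!x. P3 x = y"
      using P unfolding permutes_def P3_def comp_def by (metis swap_swap)
  qed
  have fin: "finite A" by (simp add: A_def)
  have "sign P3 = sign P"
    by (rule sign_transport[where A = "{..<b} \<times> {..<a}" and f = prod.swap])
      (use P P3 im in \<open>auto simp: P3_def\<close>)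
  also have "\<dots> = zol a j"
    unfolding P_def using sign_block[of "{..<b}" "\<lambda>_. mulmap a j" "\<lambda>_. a"] mulmap_permutes[OF cop(1)]
      \<open>odd b\<close> by (simp add: zol_def sign_power_odd)
  finally have s3: "sign P3 = zol a j" .
  have s1: "sign P1 = zol b j"
    unfolding P1_def using sign_block[of "{..<a}" "\<lambda>_. mulmap b j" "\<lambda>_. b"] mulmap_permutes[OF cop(2)]
      \<open>odd a\<close> by (simp add: zol_def sign_power_odd)
  \<comment> \<open>Rotations of odd length are even, so the carries contribute nothing to the
    sign.\<close>
  have "sign (rotmap b) = 1"
    by (rule sign_odd_order[OF _ rotmap_permutes rotmap_period]) (auto simp: \<open>odd b\<close>)
  then have "sign (rotmap b ^^ k) = 1" for k
    using sign_funpow[OF _ rotmap_permutes, of b k] by simp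
  then have s2: "sign P2 = 1"
    unfolding P2_def using sign_block[of "{..<a}" "\<lambda>s. rotmap b ^^ (j * s div a)" "\<lambda>_. b"]
      permutes_funpow[OF rotmap_permutes] by simp
  have eq: "mulmap (a * b) j (e w) = e ((P3 \<circ> (P2 \<circ> P1)) w)" if "w \<in> A" for w
  proof -
    obtain s q where w: "w = (s, q)" "s < a" "q < b" using \<open>w \<in> A\<close> by (auto simp: A_def)
    have "q * a + s < a * b" using e_im that w by (auto simp: e_def)
    then have "mulmap (a * b) j (e w) = j * (q * a + s) mod (a * b)"
      using w by (simp add: mulmap_def e_def)
    also have "\<dots> = (j * (q * a + s)) div a mod b * a + (j * (q * a + s)) mod a"
      by (simp add: mod_mult2_eq mult.commute)
    also have "(j * (q * a + s)) div a = j * q + j * s div a"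
    proof -
      have "j * (q * a + s) = j * s + (j * q) * a" by (simp add: algebra_simps)
      then show ?thesis using a0 by (simp only: div_mult_self1)
    qed
    also have "(j * (q * a + s)) mod a = j * s mod a"
    proof -
      have "j * (q * a + s) = j * s + (j * q) * a" by (simp add: algebra_simps)
      then show ?thesis by (simp only: mod_mult_self1)
    qed
    also have "(j * q + j * s div a) mod b * a + j * s mod a = e ((P3 \<circ> (P2 \<circ> P1)) w)"
      using w a0 by (simp add: P1_def P2_def P3_def P_def block_def mulmap_def funpow_rotmap e_def mod_add_left_eq)
    finally show ?thesis .
  qed
  have P21: "(P2 \<circ> P1) permutes A" by (rule permutes_compose[OF P1 P2])
  have P321: "P3 \<circ> (P2 \<circ> P1) permutes A" by (rule permutes_compose[OF P21 P3])
  have "mulmap (a * b) j permutes e ` A" unfolding e_im using mulmap_permutes[OF assms(3)] .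
  then have "zol (a * b) j = sign (P3 \<circ> (P2 \<circ> P1))"
    unfolding zol_def by (rule sign_transport[OF fin P321 e_inj]) (rule eq)
  also have "\<dots> = sign P3 * (sign P2 * sign P1)"
    by (simp only: sign_mult_permutes[OF fin P3 P21] sign_mult_permutes[OF fin P2 P1])
  finally show ?thesis by (simp add: s1 s2 s3)
qed

subsection \<open>Permutations with prescribed cycles\<close>

text \<open>Coordinates in which \<open>x\<close> advances the position on each cycle by one. Cycles
  are named by an index set because several may have the same length; for distinct parts the length
  itself serves as index.\<close>

locale cycle_model =
  fixes S :: "'a set" and x :: "'a \<Rightarrow> 'a" and I :: "'i set" and len :: "'i \<Rightarrow> nat"
    and f :: "'i \<times> nat \<Rightarrow> 'a"
  assumes finI: "finite I" and perm: "x permutes S"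
    and f: "bij_betw f (SIGMA a:I. {..<len a}) S"
    and act: "\<And>a i. a \<in> I \<Longrightarrow> i < len a \<Longrightarrow> x (f (a, i)) = f (a, Suc i mod len a)"
begin

abbreviation "\<Omega> \<equiv> SIGMA a:I. {..<len a}"

lemma f_cases:
  assumes "s \<in> S"
  obtains a i where "a \<in> I" "i < len a" "s = f (a, i)"
  using assms f by (auto simp: bij_betw_def)

lemma f_eq: "a \<in> I \<Longrightarrow> i < len a \<Longrightarrow> b \<in> I \<Longrightarrow> k < len b \<Longrightarrow> f (a, i) = f (b, k) \<longleftrightarrow> a = b \<and> i = k"
  using f by (auto simp: bij_betw_def inj_on_def)

lemma finS: "finite S"
  using f finI bij_betw_finite[OF f] by auto

lemma funpow_act: "a \<in> I \<Longrightarrow> i < len a \<Longrightarrow> (x ^^ k) (f (a, i)) = f (a, (i + k) mod len a)"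
proof (induction k)
  case (Suc k)
  then have "(i + k) mod len a < len a" by (metis mod_less_divisor gr_implies_not0 gr0I)
  with Suc show ?case by (simp add: act mod_Suc_eq)
qed auto

lemma fixed_iff:
  assumes "a \<in> I" "i < len a"
  shows "(x ^^ k) (f (a, i)) = f (a, i) \<longleftrightarrow> len a dvd k"
proof -
  have "(i + k) mod len a = i \<longleftrightarrow> [i + k = i + 0] (mod len a)"
    using assms by (simp add: cong_def)
  also have "\<dots> \<longleftrightarrow> len a dvd k"
    by (simp only: cong_add_lcancel_nat cong_0_iff)
  finally show ?thesis
    using assms funpow_act f_eq[of a "(i + k) mod len a" a i] by simp
qed

lemma funpow_id_iff:
  assumes "\<And>a. a \<in> I \<Longrightarrow> 0 < len a"
  shows "x ^^ k = id \<longleftrightarrow> (\<forall>a\<in>I. len a dvd k)"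
proof
  assume "x ^^ k = id"
  then show "\<forall>a\<in>I. len a dvd k" using fixed_iff[of _ 0 k] assms by auto
next
  assume *: "\<forall>a\<in>I. len a dvd k"
  show "x ^^ k = id"
  proof
    fix s
    show "(x ^^ k) s = id s"
      using * fixed_iff permutes_not_in[OF permutes_funpow[OF perm]] f_cases[of s]
      by (cases "s \<in> S") (metis id_apply)+
  qed
qed

lemma transport:
  assumes p: "p permutes \<Omega>"
  obtains g where "g permutes S" "sign g = sign p" "\<And>w. w \<in> \<Omega> \<Longrightarrow> g (f w) = f (p w)"
proof
  have inj: "inj_on f \<Omega>" using f by (simp add: bij_betw_def)
  show "map_permutation \<Omega> f p permutes S"
    by (rule map_permutation_permutes[OF f p])
  show "sign (map_permutation \<Omega> f p) = sign p"
    by (rule sign_map_permutation[OF inj p]) (use finI in auto)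
  show "map_permutation \<Omega> f p (f w) = f (p w)" if "w \<in> \<Omega>" for w
    by (rule map_permutation_apply[OF inj that])
qed

lemma eq_on_S:
  assumes "g permutes S" "h permutes S" "\<And>a i. a \<in> I \<Longrightarrow> i < len a \<Longrightarrow> g (f (a, i)) = h (f (a, i))"
  shows "g = h"
proof
  fix s show "g s = h s"
  proof (cases "s \<in> S")
    case True
    then show ?thesis using f_cases assms(3) by blast
  next
    case False
    then show ?thesis using permutes_not_in[OF assms(1)] permutes_not_in[OF assms(2)] by simp
  qed
qed

text \<open>Multiplication by \<open>j\<close> on each cycle, viewed as a copy of the integers modulo its length.\<close>

lemma multiplier:
  assumes cop: "\<And>a. a \<in> I \<Longrightarrow> coprime j (len a)"
  obtains g where "g permutes S" "g \<circ> x = (x ^^ j) \<circ> g" "sign g = (\<Prod>a\<in>I. zol (len a) j)"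
proof -
  define p where "p = block I (\<lambda>a. mulmap (len a) j)"
  have p: "p permutes \<Omega>"
    unfolding p_def by (rule block_permutes) (rule mulmap_permutes[OF cop])
  obtain g where g: "g permutes S" "sign g = sign p" "\<And>w. w \<in> \<Omega> \<Longrightarrow> g (f w) = f (p w)"
    using transport[OF p] by blast
  have gf: "g (f (a, i)) = f (a, j * i mod len a)" if "a \<in> I" "i < len a" for a i
    using g(3)[of "(a, i)"] that by (simp add: p_def block_def mulmap_def)
  have "g \<circ> x = (x ^^ j) \<circ> g"
  proof (rule eq_on_S)
    fix a i assume *: "a \<in> I" "i < len a"
    then have m: "k mod len a < len a" for k by simp
    have "j * (Suc i mod len a) mod len a = (j * i mod len a + j) mod len a"
      by (metis mod_mult_right_eq mod_add_left_eq mult_Suc_right add.commute)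
    then show "(g \<circ> x) (f (a, i)) = ((x ^^ j) \<circ> g) (f (a, i))"
      using * m gf funpow_act act by simp
  qed (use g perm permutes_compose permutes_funpow in blast)+
  moreover have "sign g = (\<Prod>a\<in>I. zol (len a) j)"
    unfolding g(2) p_def zol_def by (rule sign_block[OF finI]) (rule mulmap_permutes[OF cop])
  ultimately show thesis using that g(1) by blast
qed

text \<open>A permutation commuting with \<open>x\<close> maps cycles to cycles of equal length,
  hence each cycle to itself, and acts on it as a power of \<open>x\<close>. Its order therefore
  divides the product of the lengths, which is odd.\<close>

lemma commuting_even:
  assumes len: "\<And>a. a \<in> I \<Longrightarrow> odd (len a)" "inj_on len I"
    and g: "g permutes S" "g \<circ> x = x \<circ> g"
  shows "sign g = 1"
proof (rule sign_odd_order[OF finS g(1)])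
  let ?N = "\<Prod>a\<in>I. len a"
  show "odd ?N" using len(1) finI by (induction I rule: infinite_finite_induct) auto
  have gx: "g ((x ^^ k) s) = (x ^^ k) (g s)" for k s
    using g(2) by (induction k) (auto simp: fun_eq_iff)
  show "g ^^ ?N = id"
  proof
    fix s
    show "(g ^^ ?N) s = id s"
    proof (cases "s \<in> S")
      case False
      then show ?thesis using permutes_not_in[OF permutes_funpow[OF g(1)]] by simp
    next
      case True
      then obtain a i where s: "a \<in> I" "i < len a" "s = f (a, i)" by (rule f_cases)
      have "g s \<in> S" using True permutes_in_image[OF g(1)] by blast
      then obtain b k where gs: "b \<in> I" "k < len b" "g s = f (b, k)" by (rule f_cases)
      \<comment> \<open>The length of the cycle through a point can be read off from the powers of
        \<open>x\<close> fixing it, and these are the same for \<open>s\<close> and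
        \<open>g s\<close>.\<close>
      have dvd: "len a dvd t \<longleftrightarrow> len b dvd t" for t
      proof -
        have "len a dvd t \<longleftrightarrow> (x ^^ t) s = s" using fixed_iff[OF s(1,2)] s(3) by simp
        also have "\<dots> \<longleftrightarrow> g ((x ^^ t) s) = g s" using inj_eq[OF permutes_inj[OF g(1)]] by simp
        also have "\<dots> \<longleftrightarrow> (x ^^ t) (g s) = g s" by (simp only: gx)
        also have "\<dots> \<longleftrightarrow> len b dvd t" using fixed_iff[OF gs(1,2)] gs(3) by simp
        finally show ?thesis .
      qed
      have "len a = len b"
        using dvd[of "len a"] dvd[of "len b"] by (intro dvd_antisym) simp_all
      then have "a = b" using len(2) s gs by (auto simp: inj_on_def)
      \<comment> \<open>The number of steps from position \<open>i\<close> to position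
        \<open>k\<close>; adding \<open>len a\<close> prevents truncated subtraction.\<close>
      define t where "t = k + len a - i"
      have "(i + t) mod len a = k" using gs s \<open>a = b\<close> by (simp add: t_def)
      then have t: "g s = (x ^^ t) s" using funpow_act[of a i t] s gs \<open>a = b\<close> by simp
      have gk: "(g ^^ k) s = (x ^^ (t * k)) s" for k :: nat
      proof (induction k)
        case (Suc k)
        have "(g ^^ Suc k) s = g ((x ^^ (t * k)) s)" using Suc by simp
        also have "\<dots> = (x ^^ (t * k)) ((x ^^ t) s)" by (simp only: gx t)
        also have "\<dots> = (x ^^ (t * Suc k)) s" 
          by (simp only: mult_Suc_right add.commute[of t "t * k"] funpow_add comp_apply)
        finally show ?case .
      qed simp
      have "len a dvd ?N" using finI s(1) by (simp add: dvd_prodI)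
      then have "len a dvd t * ?N" by simp
      then show ?thesis using gk[of ?N] fixed_iff[of a i "t * ?N"] s by simp
    qed
  qed
qed

text \<open>The witness is the restriction of \<open>x\<close> to this one cycle, an odd permutation
  because its length is even.\<close>

lemma even_length_commuting_odd:
  assumes "a \<in> I" "even (len a)" "0 < len a"
  shows "\<exists>g. g permutes S \<and> g \<circ> x = x \<circ> g \<and> sign g = -1"
proof -
  define q where "q = block I (\<lambda>b. if b = a then rotmap (len b) else id)"
  have q: "q permutes \<Omega>"
    unfolding q_def by (rule block_permutes) (auto simp: rotmap_permutes permutes_id)
  have "sign q = (\<Prod>b\<in>I. sign (if b = a then rotmap (len b) else id))"
    unfolding q_def by (rule sign_block[OF finI, where len = len]) (auto simp: rotmap_permutes permutes_id)
  also have "\<dots> = (\<Prod>b\<in>I. if b = a then sign (rotmap (len b)) else 1)"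
    by (rule prod.cong) auto
  also have "\<dots> = sign (rotmap (len a))" using assms(1) finI by simp
  also have "\<dots> = -1" using assms(2,3) sign_rotmap[of "len a - 1"] by simp
  finally have sq: "sign q = -1" .
  obtain g where g: "g permutes S" "sign g = sign q" "\<And>w. w \<in> \<Omega> \<Longrightarrow> g (f w) = f (q w)"
    using transport[OF q] by blast
  have "g \<circ> x = x \<circ> g"
  proof (rule eq_on_S)
    fix b i assume *: "b \<in> I" "i < len b"
    then have m: "k mod len b < len b" for k by simp
    have gf: "g (f (b, i)) = (if b = a then x (f (b, i)) else f (b, i))" if "i < len b" for i
      using g(3)[of "(b, i)"] * that by (auto simp: q_def block_def rotmap_def act)
    show "(g \<circ> x) (f (b, i)) = (x \<circ> g) (f (b, i))"
      using act[OF *] gf[OF *(2)] gf[OF m[of "Suc i"]] by (auto split: if_splits)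
  qed (use g perm permutes_compose in blast)+
  then show ?thesis using g(1,2) sq by (intro exI[of _ g]) simp
qed

text \<open>The witness exchanges the two cycles position by position, which takes
  \<open>len a\<close> transpositions, an odd number.\<close>

lemma equal_lengths_commuting_odd:
  assumes ab: "a \<in> I" "b \<in> I" "a \<noteq> b" "len a = len b" "odd (len a)"
  shows "\<exists>g. g permutes S \<and> g \<circ> x = x \<circ> g \<and> sign g = -1"
proof -
  define sw where "sw k = (\<lambda>(c, i). (if i < k then transpose a b c else c, i :: nat))" for k
  have sw: "permutation (sw k) \<and> sign (sw k) = (-1) ^ k" for k
  proof (induction k)
    case 0
    have "sw 0 = id" by (auto simp: sw_def)
    then show ?case by simp
  next
    case (Suc k)
    have "sw (Suc k) = transpose (a, k) (b, k) \<circ> sw k"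
      by (auto simp: fun_eq_iff sw_def transpose_def)
    moreover have "permutation (sw k)" "sign (sw k) = (-1) ^ k" "(a, k) \<noteq> (b, k)" using Suc ab by auto
    ultimately show ?case
      by (metis (lifting) sign_compose permutation_compose permutation_swap_id sign_swap_id power_Suc)
  qed
  define q where "q = sw (len a)"
  have q: "q permutes \<Omega>"
  proof (rule bij_imp_permutes)
    have "q w \<in> \<Omega>" if "w \<in> \<Omega>" for w
      using that ab by (auto simp: q_def sw_def transpose_def)
    moreover have "inj_on q \<Omega>"
      using sw[of "len a"] permutation_bijective unfolding q_def
      by (metis bij_is_inj inj_on_subset subset_UNIV)
    moreover have "finite \<Omega>" using finI by auto
    ultimately show "bij_betw q \<Omega> \<Omega>"
      by (metis bij_betw_def endo_inj_surj image_subsetI)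
    show "q w = w" if "w \<notin> \<Omega>" for w
      using that ab by (cases w) (auto simp: q_def sw_def transpose_def)
  qed
  obtain g where g: "g permutes S" "sign g = sign q" "\<And>w. w \<in> \<Omega> \<Longrightarrow> g (f w) = f (q w)"
    using transport[OF q] by blast
  have "g \<circ> x = x \<circ> g"
  proof (rule eq_on_S)
    fix c i assume *: "c \<in> I" "i < len c"
    then have m: "k mod len c < len c" for k by simp
    define d where "d = (if c = a then b else if c = b then a else c)"
    have d: "d \<in> I" "len d = len c" using * ab by (auto simp: d_def)
    have gf: "g (f (c, i)) = f (d, i)" if "i < len c" for i
      using g(3)[of "(c, i)"] * that ab by (auto simp: q_def sw_def transpose_def d_def)
    show "(g \<circ> x) (f (c, i)) = (x \<circ> g) (f (c, i))"
      using * m d by (simp add: gf act)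
  qed (use g perm permutes_compose in blast)+
  moreover have "sign g = -1" using g(2) sw[of "len a"] ab(5) by (simp add: q_def)
  ultimately show ?thesis using g(1) by (intro exI[of _ g]) simp
qed

end

text \<open>The witness indexes the cycles by their least elements.\<close>

lemma cycle_model_exists:
  fixes x :: "nat \<Rightarrow> nat"
  assumes x: "x permutes S" and "finite S"
  obtains I len f where "cycle_model S x I len f" "\<And>a::nat. a \<in> I \<Longrightarrow> 0 < len a"
proof -
  have px: "permutation x" using assms permutes_imp_permutation by blast
  define I where "I = {a \<in> S. \<forall>i. a \<le> (x ^^ i) a}"
  define len where "len = least_power x"
  define f where "f = (\<lambda>(a, i). (x ^^ i) a)"
  have len0: "0 < len a" for a
    unfolding len_def using least_power_of_permutation[OF px] by simp
  have per: "(x ^^ k) a = (x ^^ (k mod len a)) a" for k a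
    using least_power_of_permutation(1)[OF px, of a] funpow_mod_eq[where f = x and n = "len a" and x = a and m = k] by (simp add: len_def)
  have ret: "\<exists>t. a = (x ^^ t) ((x ^^ k) a)" for k a
  proof
    \<comment> \<open>The total \<open>k * len a\<close> is a multiple of the period and at least
      \<open>k\<close>, so the remaining steps lead back to \<open>a\<close>.\<close>
    have "(x ^^ (k * len a - k)) ((x ^^ k) a) = (x ^^ (k * len a)) a"
      using len0[of a] by (metis comp_apply funpow_add le_add_diff_inverse2 mult_le_mono2 mult.right_neutral Suc_leI One_nat_def)
    also have "\<dots> = a" using per[of "k * len a" a] by simp
    finally show "a = (x ^^ (k * len a - k)) ((x ^^ k) a)" ..
  qed
  have "inj_on f (SIGMA a:I. {..<len a})"
  proof (rule inj_onI)
    fix v w assume *: "v \<in> (SIGMA a:I. {..<len a})" "w \<in> (SIGMA a:I. {..<len a})" "f v = f w"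
    obtain a i b k where vw: "v = (a, i)" "w = (b, k)" by fastforce
    then have ab: "a \<in> I" "b \<in> I" "(x ^^ i) a = (x ^^ k) b" "i < len a" "k < len b"
      using * by (auto simp: f_def)
    obtain t where "a = (x ^^ t) ((x ^^ k) b)" using ret[of a i] ab by auto
    moreover obtain t' where "b = (x ^^ t') ((x ^^ i) a)" using ret[of b k] ab by auto
    ultimately have "a = (x ^^ (t + k)) b" "b = (x ^^ (t' + i)) a" by (simp_all add: funpow_add)
    \<comment> \<open>Two representatives on the same orbit are each at most the other, hence
      equal.\<close>
    moreover have "b \<le> (x ^^ (t + k)) b" "a \<le> (x ^^ (t' + i)) a" using ab(1,2) by (auto simp: I_def)
    ultimately have "a = b" by simp
    moreover have "i = k"
      using cycle_of_permutation[OF px, of a] ab \<open>a = b\<close>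
      by (auto simp: distinct_map inj_on_def len_def)
    ultimately show "v = w" using vw by simp
  qed
  moreover have "f ` (SIGMA a:I. {..<len a}) = S"
  proof (intro equalityI subsetI)
    fix s assume "s \<in> f ` (SIGMA a:I. {..<len a})"
    then show "s \<in> S"
      using permutes_in_image[OF permutes_funpow[OF x]] by (auto simp: f_def I_def)
  next
    fix s assume s: "s \<in> S"
    define a where "a = (LEAST t. \<exists>i. t = (x ^^ i) s)"
    have "\<exists>i. a = (x ^^ i) s" unfolding a_def by (rule LeastI_ex) (auto intro: exI[of _ 0])
    then obtain i where i: "a = (x ^^ i) s" ..
    have "a \<le> (x ^^ k) a" for k
      by (subst a_def, rule Least_le) (auto simp: i funpow_add[symmetric] simp flip: comp_apply[of "x ^^ k"])
    moreover have "a \<in> S" using i s permutes_in_image[OF permutes_funpow[OF x]] by simp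
    ultimately have aI: "a \<in> I" by (simp add: I_def)
    obtain t where "s = (x ^^ t) a" using ret i by blast
    then have "s = f (a, t mod len a)" using per by (simp add: f_def)
    moreover have "(a, t mod len a) \<in> (SIGMA a:I. {..<len a})" using aI len0[of a] by simp
    ultimately show "s \<in> f ` (SIGMA a:I. {..<len a})" by blast
  qed
  ultimately have "bij_betw f (SIGMA a:I. {..<len a}) S" by (simp add: bij_betw_def)
  moreover have "x (f (a, i)) = f (a, Suc i mod len a)" for a i
    using per[of "Suc i" a] by (simp add: f_def)
  moreover have "finite I" using assms(2) by (simp add: I_def)
  ultimately have "cycle_model S x I len f" using x by unfold_locales auto
  then show thesis using that len0 by blast
qed

text \<open>Any bijection between the coordinate pairs and \<open>{1..n}\<close> does; the rotations
  of the coordinates are carried over along it.\<close>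

lemma cycle_model_of_parts:
  assumes "finite L" "\<And>m. m \<in> L \<Longrightarrow> 0 < m" "\<Sum>L = n"
  obtains x f where "cycle_model {1..n} x L id f"
proof -
  let ?W = "SIGMA a:L. {..<id a}"
  have "card ?W = card {1..n}" using assms by simp
  then obtain f where f: "bij_betw f ?W {1..n}"
    using finite_same_card_bij assms(1) by (metis finite_SigmaI finite_atLeastAtMost finite_lessThan)
  define p where "p = block L rotmap"
  have p: "p permutes ?W" unfolding p_def by (rule block_permutes) (simp add: rotmap_permutes)
  have inj: "inj_on f ?W" using f by (simp add: bij_betw_def)
  have "cycle_model {1..n} (map_permutation ?W f p) L id f"
  proof
    show "map_permutation ?W f p permutes {1..n}" by (rule map_permutation_permutes[OF f p])
    fix a i assume "a \<in> L" "i < id a"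
    then show "map_permutation ?W f p (f (a, i)) = f (a, Suc i mod id a)"
      using map_permutation_apply[OF inj, of "(a, i)" p] by (simp add: p_def block_def rotmap_def)
  qed (use assms f in auto)
  then show thesis by (rule that)
qed

subsection \<open>Semi-rationality of alternating groups\<close>

lemma alt_group_pow:
  assumes "x \<in> carrier (alt_group n)"
  shows "x [^]\<^bsub>alt_group n\<^esub> (k::nat) = x ^^ k"
proof (induction k)
  case 0
  then show ?case by (simp add: alt_group_one nat_pow_def)
next
  case (Suc k)
  interpret group "alt_group n" by (rule alt_group_is_group)
  show ?case
    by (simp only: nat_pow_Suc Suc alt_group_mult funpow_Suc_right)
qed

lemma finite_carrier_alt_group: "finite (carrier (alt_group n))"
  by (rule finite_subset[OF _ finite_permutations[of "{1..n}"]]) (auto simp: alt_group_carrier)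

lemma conjugate_in_alt_group:
  assumes "y \<in> carrier (alt_group n)"
  shows "conjugate_in (alt_group n) y x \<longleftrightarrow>
    (\<exists>g. g permutes {1..n} \<and> evenperm g \<and> x \<circ> g = g \<circ> y)"
proof -
  have "x = g \<circ> y \<circ> inv' g \<longleftrightarrow> x \<circ> g = g \<circ> y" if "g permutes {1..n}" for g
    using permutes_inv_o[OF that] by (metis comp_assoc comp_id)
  then show ?thesis
    unfolding conjugate_in_def Bex_def alt_group_mult
    using alt_group_inv_equality alt_group_carrier by metis
qed

text \<open>In a finite group natural exponents exhaust a cyclic subgroup, so being a generator
  means that the exponent \<open>k\<close> can be undone by some \<open>l\<close>.\<close>

lemma generate_eq_alt_group:
  assumes "x \<in> carrier (alt_group n)"
  shows "generate (alt_group n) {x ^^ k} = generate (alt_group n) {x} \<longleftrightarrow> (\<exists>l. x ^^ (k * l) = x)"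
proof -
  interpret group "alt_group n" by (rule alt_group_is_group)
  have y: "x ^^ k \<in> carrier (alt_group n)"
    using alt_group_pow[OF assms, of k] assms nat_pow_closed by metis
  have gen: "generate (alt_group n) {z} = {z ^^ i | i. i \<in> UNIV}" if "z \<in> carrier (alt_group n)" for z
    using generate_pow_on_finite_carrier[OF finite_carrier_alt_group that] alt_group_pow[OF that] by simp
  have "x ^^ k \<in> generate (alt_group n) {x}" using gen[OF assms] by blast
  then have sub: "generate (alt_group n) {x ^^ k} \<subseteq> generate (alt_group n) {x}"
    using generate_subgroup_incl[OF _ generate_is_subgroup[of "{x}"]] assms by simp
  show ?thesis
  proof
    assume "generate (alt_group n) {x ^^ k} = generate (alt_group n) {x}"
    then have "x \<in> generate (alt_group n) {x ^^ k}" using generate.incl[of x "{x}"] by simp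
    then obtain l where "x = (x ^^ k) ^^ l" unfolding gen[OF y] by blast
    then have "x ^^ (k * l) = x" by (simp add: funpow_mult mult.commute)
    then show "\<exists>l. x ^^ (k * l) = x" ..
  next
    assume "\<exists>l. x ^^ (k * l) = x"
    then obtain l where "x ^^ (k * l) = x" ..
    then have "x = (x ^^ k) ^^ l" by (simp add: funpow_mult mult.commute)
    then have "x \<in> generate (alt_group n) {x ^^ k}"
      unfolding gen[OF y] by blast
    then show "generate (alt_group n) {x ^^ k} = generate (alt_group n) {x}"
      using generate_subgroup_incl[OF _ generate_is_subgroup[of "{x ^^ k}"], of "{x}"] y sub by auto
  qed
qed

lemma semi_rational_element_alt_group:
  assumes x: "x \<in> carrier (alt_group n)" and r: "x [^]\<^bsub>alt_group n\<^esub> (r::int) = x ^^ s"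
  shows "semi_rational_element (alt_group n) r x \<longleftrightarrow>
    (\<forall>k l. x ^^ (k * l) = x \<longrightarrow> (\<exists>g. g permutes {1..n} \<and> evenperm g \<and>
      (x \<circ> g = g \<circ> x ^^ k \<or> x ^^ s \<circ> g = g \<circ> x ^^ k)))"
proof -
  interpret group "alt_group n" by (rule alt_group_is_group)
  have y: "x ^^ k \<in> carrier (alt_group n)" for k
    using alt_group_pow[OF x, of k] x nat_pow_closed by metis
  have "generate (alt_group n) {x} = {x ^^ k | k. k \<in> UNIV}"
    using generate_pow_on_finite_carrier[OF finite_carrier_alt_group x] alt_group_pow[OF x] by simp
  then have ball: "(\<forall>y\<in>generate (alt_group n) {x}. Q y) \<longleftrightarrow> (\<forall>k. Q (x ^^ k))" for Q
    by auto
  have "semi_rational_element (alt_group n) r x \<longleftrightarrow>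
      (\<forall>k. (\<exists>l. x ^^ (k * l) = x) \<longrightarrow>
        conjugate_in (alt_group n) (x ^^ k) x \<or> conjugate_in (alt_group n) (x ^^ k) (x ^^ s))"
    unfolding semi_rational_element_def r ball generate_eq_alt_group[OF x] ..
  also have "\<dots> \<longleftrightarrow> (\<forall>k l. x ^^ (k * l) = x \<longrightarrow> (\<exists>g. g permutes {1..n} \<and> evenperm g \<and>
      (x \<circ> g = g \<circ> x ^^ k \<or> x ^^ s \<circ> g = g \<circ> x ^^ k)))"
    unfolding conjugate_in_alt_group[OF y] by blast
  finally show ?thesis .
qed

lemma uniformly_semi_rational_alt_group:
  "uniformly_semi_rational (alt_group n) \<longleftrightarrow>
    (\<exists>s::nat. \<forall>x. x permutes {1..n} \<longrightarrow> evenperm x \<longrightarrow> (\<forall>k l. x ^^ (k * l) = x \<longrightarrow>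
      (\<exists>g. g permutes {1..n} \<and> evenperm g \<and>
        (x \<circ> g = g \<circ> x ^^ k \<or> x ^^ s \<circ> g = g \<circ> x ^^ k))))" (is "_ \<longleftrightarrow> (\<exists>s. ?P s)")
proof -
  interpret group "alt_group n" by (rule alt_group_is_group)
  have iff: "semi_rational_group (alt_group n) r \<longleftrightarrow> ?P s"
    if "\<And>x. x \<in> carrier (alt_group n) \<Longrightarrow> x [^]\<^bsub>alt_group n\<^esub> (r::int) = x ^^ s" for r s
  proof -
    have "semi_rational_group (alt_group n) r \<longleftrightarrow>
        (\<forall>x\<in>carrier (alt_group n). semi_rational_element (alt_group n) r x)"
      unfolding semi_rational_group_def using alt_group_is_group finite_carrier_alt_group by blast
    also have "\<dots> \<longleftrightarrow> ?P s"
      using semi_rational_element_alt_group[OF _ that] unfolding Ball_def alt_group_carrier by auto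
    finally show ?thesis .
  qed
  show ?thesis
    unfolding uniformly_semi_rational_def
  proof
    assume "\<exists>r. semi_rational_group (alt_group n) r"
    then obtain r where r: "semi_rational_group (alt_group n) r" ..
    define N where "N = order (alt_group n)"
    have N: "N > 0" unfolding N_def using order_gt_0_iff_finite finite_carrier_alt_group by blast
    \<comment> \<open>All elements are annihilated by the group order, so reducing \<open>r\<close>
      modulo it gives one natural exponent valid for every \<open>x\<close>.\<close>
    define s where "s = nat (r mod int N)"
    have "x [^]\<^bsub>alt_group n\<^esub> r = x ^^ s" if x: "x \<in> carrier (alt_group n)" for x
    proof -
      have "r = int N * (r div int N) + int s" using N by (simp add: s_def)
      then have "x [^]\<^bsub>alt_group n\<^esub> r =
          (x [^]\<^bsub>alt_group n\<^esub> int N) [^]\<^bsub>alt_group n\<^esub> (r div int N) \<otimes>\<^bsub>alt_group n\<^esub> x [^]\<^bsub>alt_group n\<^esub> int s"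
        using int_pow_mult[OF x] int_pow_pow[OF x] by metis
      also have "x [^]\<^bsub>alt_group n\<^esub> int N = \<one>\<^bsub>alt_group n\<^esub>"
        using pow_order_eq_1[OF x] by (simp add: N_def int_pow_int)
      finally show ?thesis
        using alt_group_pow[OF x, of s] nat_pow_closed[OF x, of s] by (simp add: int_pow_int)
    qed
    then show "\<exists>s. ?P s" using iff r by blast
  next
    assume "\<exists>s. ?P s"
    then obtain s where "?P s" ..
    moreover have "x [^]\<^bsub>alt_group n\<^esub> int s = x ^^ s" if "x \<in> carrier (alt_group n)" for x
      using alt_group_pow[OF that] by (simp add: int_pow_int)
    ultimately show "\<exists>r. semi_rational_group (alt_group n) r" using iff by blast
  qed
qed

subsection \<open>Partitions into distinct odd parts\<close>

definition odd_parts :: "nat \<Rightarrow> nat set \<Rightarrow> bool" where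
  "odd_parts n L \<longleftrightarrow> finite L \<and> (\<forall>m\<in>L. odd m) \<and> \<Sum>L = n"

lemma odd_parts_prod: "odd_parts n L \<Longrightarrow> odd (\<Prod>L)"
  unfolding odd_parts_def by (metis even_prod_iff)

lemma coprime_prod_nat: "finite L \<Longrightarrow> coprime j (\<Prod>L) \<longleftrightarrow> (\<forall>m\<in>L. coprime j m)" for j :: nat
  by (induction L rule: finite_induct) auto

lemma zol_prod:
  assumes "finite L" "\<forall>m\<in>L. odd m" "coprime j (\<Prod>L)"
  shows "zol (\<Prod>L) j = (\<Prod>m\<in>L. zol m j)"
  using assms
proof (induction L)
  case (insert m L)
  then have "zol (m * \<Prod>L) j = zol m j * zol (\<Prod>L) j"
    by (intro zol_mult_left) (auto simp: even_prod_iff)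
  with insert show ?case by auto
qed simp

text \<open>Take \<open>x\<close> with cycle lengths \<open>L\<close>. The multiplier by
  \<open>j\<close> conjugates \<open>x\<close> to its \<open>j\<close>-th power and is odd; as only
  even permutations commute with \<open>x\<close>, that power is not conjugate to \<open>x\<close>
  in the alternating group. It must be conjugate to the \<open>r\<close>-th power, and comparison
  with the multiplier by \<open>r\<close> gives the symbol of \<open>r\<close>.\<close>

lemma semi_rational_exponent_zol:
  assumes "uniformly_semi_rational (alt_group n)"
  obtains r where "\<And>L j. odd_parts n L \<Longrightarrow> coprime j (\<Prod>L) \<Longrightarrow> zol (\<Prod>L) j = -1 \<Longrightarrow>
    coprime r (\<Prod>L) \<and> zol (\<Prod>L) r = -1"
proof -
  obtain r where r: "\<And>x k l. x permutes {1..n} \<Longrightarrow> evenperm x \<Longrightarrow> x ^^ (k * l) = x \<Longrightarrow>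
      \<exists>g. g permutes {1..n} \<and> evenperm g \<and> (x \<circ> g = g \<circ> x ^^ k \<or> x ^^ r \<circ> g = g \<circ> x ^^ k)"
    using assms unfolding uniformly_semi_rational_alt_group by blast
  have "coprime r (\<Prod>L) \<and> zol (\<Prod>L) r = -1"
    if L: "odd_parts n L" and j: "coprime j (\<Prod>L)" and z: "zol (\<Prod>L) j = -1" for L j
  proof -
    have fL: "finite L" and oL: "\<forall>m\<in>L. odd m" and sL: "\<Sum>L = n" using L by (auto simp: odd_parts_def)
    have pos: "\<And>m. m \<in> L \<Longrightarrow> 0 < m" using oL odd_pos by blast
    obtain x f where "cycle_model {1..n} x L id f"
      using cycle_model_of_parts[OF fL pos sL] by blast
    then interpret cycle_model "{1..n}" x L id f .
    define N where "N = \<Prod>L"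
    have N: "odd N" using odd_parts_prod[OF L] by (simp add: N_def)
    have id_iff: "x ^^ k = id \<longleftrightarrow> (\<forall>m\<in>L. m dvd k)" for k
      using funpow_id_iff pos by simp
    have "m dvd N" if "m \<in> L" for m unfolding N_def
      using dvd_prodI[OF fL that, of "\<lambda>m. m"] by simp
    then have xN: "x ^^ N = id" using id_iff by blast
    have "sign x = 1" by (rule sign_odd_order[OF finS perm xN N])
    then have ev: "evenperm x" by (simp add: sign_def split: if_splits)
    \<comment> \<open>An inverse of \<open>j\<close> modulo \<open>N\<close> shows that the
      \<open>j\<close>-th power of \<open>x\<close> generates the same subgroup.\<close>
    obtain l where l: "[j * l = Suc 0] (mod N)"
      using cong_solve_coprime_nat[OF j] unfolding N_def by auto
    have xmod: "x ^^ k = x ^^ (k mod N)" for k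
    proof
      fix s
      have "(x ^^ N) s = s" by (simp add: xN)
      from funpow_mod_eq[OF this, of k] show "(x ^^ k) s = (x ^^ (k mod N)) s" ..
    qed
    have "x ^^ (j * l) = x ^^ Suc 0"
      using l xmod[of "j * l"] xmod[of "Suc 0"] by (simp only: cong_def)
    then obtain g where g: "g permutes {1..n}" "evenperm g"
        "x \<circ> g = g \<circ> x ^^ j \<or> x ^^ r \<circ> g = g \<circ> x ^^ j"
      using r[OF perm ev, of j l] by auto
    have sg: "sign g = 1" using g(2) by (simp add: sign_def)
    obtain h where h: "h permutes {1..n}" "h \<circ> x = x ^^ j \<circ> h" "sign h = (\<Prod>m\<in>L. zol (id m) j)"
      using multiplier[of j] j coprime_prod_nat[OF fL] by auto
    have sh: "sign h = -1" using h(3) z zol_prod[OF fL oL j] by simp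
    have gh: "g \<circ> h permutes {1..n}" using permutes_compose[OF h(1) g(1)] .
    have sgh: "sign (g \<circ> h) = -1" using sign_mult_permutes[OF finS g(1) h(1)] sg sh by simp
    have even: "sign c = 1" if "c permutes {1..n}" "c \<circ> x = x \<circ> c" for c
      using commuting_even[of c] oL that by simp
    \<comment> \<open>Otherwise \<open>g\<close> after \<open>h\<close> would be an odd permutation
      commuting with \<open>x\<close>.\<close>
    have "x \<circ> g \<noteq> g \<circ> x ^^ j"
    proof
      assume "x \<circ> g = g \<circ> x ^^ j"
      then have "(g \<circ> h) \<circ> x = x \<circ> (g \<circ> h)" using h(2) by (metis comp_assoc)
      then show False using even[OF gh] sgh by simp
    qed
    then have conj: "(g \<circ> h) \<circ> x = x ^^ r \<circ> (g \<circ> h)" using g(3) h(2) by (metis comp_assoc)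
    have conj1: "g (h (x s)) = (x ^^ r) (g (h s))" for s
      using fun_cong[OF conj, of s] by simp
    have conjk: "g (h ((x ^^ k) s)) = (x ^^ (r * k)) (g (h s))" for k s
      by (induction k) (simp_all add: conj1 funpow_add)
    \<comment> \<open>A common divisor \<open>p\<close> of \<open>r\<close> and \<open>m\<close>
      would make the power \<open>r * M\<close> of \<open>x\<close> trivial for
      \<open>M = Lcm L div p\<close>. That power is conjugate to the power \<open>M\<close>, which
      forces \<open>Lcm L dvd M\<close> and so \<open>p = 1\<close>.\<close>
    have cop: "coprime r m" if m: "m \<in> L" for m
    proof (rule coprimeI)
      fix p assume p: "p dvd r" "p dvd m"
      define M where "M = Lcm L div p"
      have "0 \<notin> L" using pos by blast
      then have "0 < Lcm L" using Lcm_0_iff[OF fL] by (simp add: neq0_conv[symmetric] del: neq0_conv)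
      have "p dvd Lcm L" using p(2) m by (meson dvd_Lcm dvd_trans)
      then have "Lcm L = p * M" by (simp add: M_def)
      then have "m' dvd r * M" if "m' \<in> L" for m'
      proof -
        have "Lcm L dvd r * M" using p(1) \<open>Lcm L = p * M\<close> by (simp add: mult_dvd_mono)
        then show ?thesis using dvd_Lcm[OF that] by (rule dvd_trans[rotated])
      qed
      then have "x ^^ (r * M) = id" using id_iff by blast
      then have "(g \<circ> h) ((x ^^ M) s) = (g \<circ> h) s" for s using conjk[of M s] by simp
      then have "x ^^ M = id"
        using inj_eq[OF permutes_inj[OF gh]] by (simp add: fun_eq_iff)
      then have "Lcm L dvd M" using id_iff by (simp add: Lcm_least)
      then have "p * M \<le> M" using \<open>Lcm L = p * M\<close> \<open>0 < Lcm L\<close> by (intro dvd_imp_le) auto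
      then show "is_unit p"
        using \<open>Lcm L = p * M\<close> \<open>0 < Lcm L\<close> by simp
    qed
    obtain h' where h': "h' permutes {1..n}" "h' \<circ> x = x ^^ r \<circ> h'" "sign h' = (\<Prod>m\<in>L. zol (id m) r)"
      using multiplier[of r] cop by auto
    have c: "inv' h' \<circ> (g \<circ> h) permutes {1..n}"
      using permutes_compose[OF gh permutes_inv[OF h'(1)]] .
    have "inv' h' \<circ> x ^^ r = x \<circ> inv' h'"
      using h'(2) permutes_inv_o[OF h'(1)] by (metis comp_assoc comp_id id_comp)
    then have "inv' h' ((x ^^ r) s) = x (inv' h' s)" for s by (simp add: fun_eq_iff)
    then have "(inv' h' \<circ> (g \<circ> h)) \<circ> x = x \<circ> (inv' h' \<circ> (g \<circ> h))"
      by (simp add: fun_eq_iff conj1)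
    then have "sign (inv' h' \<circ> (g \<circ> h)) = 1" by (rule even[OF c])
    moreover have "sign (inv' h' \<circ> (g \<circ> h)) = sign h' * sign (g \<circ> h)"
      using sign_mult_permutes[OF finS permutes_inv[OF h'(1)] gh]
        sign_inverse[OF permutes_imp_permutation[OF finS h'(1)]] by simp
    ultimately have "sign h' = -1" using sgh by simp
    moreover have "coprime r (\<Prod>L)" using cop coprime_prod_nat[OF fL] by blast
    ultimately show ?thesis using h'(3) zol_prod[OF fL oL] by simp
  qed
  then show thesis using that by blast
qed

text \<open>The inverse of the multiplier by \<open>k\<close> conjugates as required. If it is odd,
  its sign is repaired by an odd permutation commuting with \<open>x\<close>, or, when there is
  none, by the multiplier by \<open>r\<close>, at the price of reaching the \<open>r\<close>-th
  power instead of \<open>x\<close>.\<close>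

lemma semi_rational_if_zol:
  assumes r: "\<And>L. odd_parts n L \<Longrightarrow> (coprime r (\<Prod>L) \<and> zol (\<Prod>L) r = -1) \<or>
    (\<forall>j. coprime j (\<Prod>L) \<longrightarrow> zol (\<Prod>L) j = 1)"
  shows "uniformly_semi_rational (alt_group n)"
  unfolding uniformly_semi_rational_alt_group
proof (intro exI[of _ r] allI impI)
  fix x :: "nat \<Rightarrow> nat" and k l
  assume x: "x permutes {1..n}" "evenperm x" "x ^^ (k * l) = x"
  obtain I len f where "cycle_model {1..n} x I len f" and pos: "\<And>a::nat. a \<in> I \<Longrightarrow> 0 < len a"
    using cycle_model_exists[OF x(1)] by auto
  then interpret cycle_model "{1..n}" x I len f by simp
  have cop: "coprime k (len a)" if a: "a \<in> I" for a
  proof -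
    \<comment> \<open>Evaluation at the start of a cycle shows that \<open>l\<close> inverts
      \<open>k\<close> modulo its length; \<open>1 mod len a\<close> accounts for fixed
      points.\<close>
    have "(x ^^ (k * l)) (f (a, 0)) = (x ^^ 1) (f (a, 0))" using x(3) by simp
    then have "f (a, (k * l) mod len a) = f (a, 1 mod len a)"
      using funpow_act[OF a pos[OF a]] by (simp only: add_0)
    then have "[k * l = 1] (mod len a)"
      using f_eq[of a "(k * l) mod len a" a "1 mod len a"] a pos[OF a] by (simp add: cong_def)
    then show ?thesis by (metis coprime_iff_invertible_nat One_nat_def)
  qed
  obtain h where h: "h permutes {1..n}" "h \<circ> x = x ^^ k \<circ> h" "sign h = (\<Prod>a\<in>I. zol (len a) k)"
    using multiplier[of k] cop by blast
  have ih: "inv' h permutes {1..n}" "sign (inv' h) = sign h"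
    using permutes_inv[OF h(1)] sign_inverse[OF permutes_imp_permutation[OF finS h(1)]] by auto
  have hx: "x \<circ> inv' h = inv' h \<circ> x ^^ k"
    using h(2) permutes_inv_o[OF h(1)] by (metis comp_assoc comp_id id_comp)
  have even_iff: "evenperm g \<longleftrightarrow> sign g = 1" for g :: "nat \<Rightarrow> nat" by (simp add: sign_def)
  show "\<exists>g. g permutes {1..n} \<and> evenperm g \<and> (x \<circ> g = g \<circ> x ^^ k \<or> x ^^ r \<circ> g = g \<circ> x ^^ k)"
  proof (cases "sign h = 1")
    case True
    then show ?thesis using ih hx even_iff by (intro exI[of _ "inv' h"]) simp
  next
    case False
    then have sh: "sign h = -1" by (cases h rule: sign_cases) auto
    show ?thesis
    proof (cases "\<exists>c. c permutes {1..n} \<and> c \<circ> x = x \<circ> c \<and> sign c = -1")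
      case True
      then obtain c where c: "c permutes {1..n}" "c \<circ> x = x \<circ> c" "sign c = -1" by blast
      have "x \<circ> (c \<circ> inv' h) = (c \<circ> inv' h) \<circ> x ^^ k"
        using c(2) hx by (metis comp_assoc)
      moreover have "sign (c \<circ> inv' h) = 1" using sign_mult_permutes[OF finS c(1) ih(1)] ih(2) sh c(3) by simp
      moreover have "c \<circ> inv' h permutes {1..n}" by (rule permutes_compose[OF ih(1) c(1)])
      ultimately show ?thesis using even_iff by (intro exI[of _ "c \<circ> inv' h"]) simp
    next
      case False
      \<comment> \<open>Without odd commuting permutations the lengths are odd and distinct, so they
        form one of the sets \<open>L\<close> of the hypothesis.\<close>
      have odd: "odd (len a)" if "a \<in> I" for a
        using even_length_commuting_odd[OF that _ pos[OF that]] False by blast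
      have inj: "inj_on len I"
        using equal_lengths_commuting_odd odd False unfolding inj_on_def by blast
      define L where "L = len ` I"
      have fL: "finite L" using finI by (simp add: L_def)
      have oL: "\<forall>m\<in>L. odd m" using odd by (auto simp: L_def)
      have "\<Sum>L = (\<Sum>a\<in>I. len a)" unfolding L_def using sum.reindex[OF inj, of id] by simp
      also have "\<dots> = card (SIGMA a:I. {..<len a})" using finI by simp
      also have "\<dots> = n" using bij_betw_same_card[OF f] by simp
      finally have L: "odd_parts n L" using fL oL by (simp add: odd_parts_def)
      have prodL: "zol (\<Prod>L) j = (\<Prod>a\<in>I. zol (len a) j)" if "coprime j (\<Prod>L)" for j
        using zol_prod[OF fL oL that] prod.reindex[OF inj, of "\<lambda>m. zol m j"] by (simp add: L_def)
      have "coprime k (\<Prod>L)" using coprime_prod_nat[OF fL] cop by (auto simp: L_def)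
      then have rL: "coprime r (\<Prod>L)" "zol (\<Prod>L) r = -1"
        using r[OF L] prodL h(3) sh by fastforce+
      then have "coprime r (len a)" if "a \<in> I" for a
        using that coprime_prod_nat[OF fL] by (auto simp: L_def)
      then obtain h' where h': "h' permutes {1..n}" "h' \<circ> x = x ^^ r \<circ> h'" "sign h' = (\<Prod>a\<in>I. zol (len a) r)"
        using multiplier[of r] by blast
      have "sign h' = -1" using prodL[OF rL(1)] rL(2) h'(3) by simp
      then have "sign (h' \<circ> inv' h) = 1" using sign_mult_permutes[OF finS h'(1) ih(1)] ih(2) sh by simp
      moreover have "x ^^ r \<circ> (h' \<circ> inv' h) = (h' \<circ> inv' h) \<circ> x ^^ k"
        using h'(2) hx by (metis comp_assoc)
      moreover have "h' \<circ> inv' h permutes {1..n}" by (rule permutes_compose[OF ih(1) h'(1)])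
      ultimately show ?thesis using even_iff by (intro exI[of _ "h' \<circ> inv' h"]) simp
    qed
  qed
qed

section \<open>Criteria for a nontrivial symbol, and the obstruction from squares\<close>

lemma zol_two_mod8:
  assumes "odd m"
  shows "zol m 2 = (if m mod 8 = 1 \<or> m mod 8 = 7 then 1 else -1)"
proof -
  define h where "h = m div 2"
  have m: "m = Suc (2 * h)" using assms by (simp add: h_def)
  \<comment> \<open>Parity of the triangular numbers, which form the exponent in
    \<open>zol_two\<close>.\<close>
  have "even (\<Sum>i\<le>k. i) \<longleftrightarrow> k mod 4 = 0 \<or> k mod 4 = 3" for k :: nat
  proof (induction k)
    case (Suc k)
    have "even (\<Sum>i\<le>Suc k. i) \<longleftrightarrow> (even (\<Sum>i\<le>k. i) \<longleftrightarrow> odd k)" by simp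
    also have "\<dots> \<longleftrightarrow> Suc k mod 4 = 0 \<or> Suc k mod 4 = 3" unfolding Suc.IH by presburger
    finally show ?case .
  qed simp
  moreover have "h mod 4 = 0 \<or> h mod 4 = 3 \<longleftrightarrow> m mod 8 = 1 \<or> m mod 8 = 7"
    unfolding m by presburger
  ultimately show ?thesis using zol_two[of h] unfolding m by (simp add: minus_one_power_iff)
qed

text \<open>For odd \<open>P\<close> this amounts to \<open>P\<close> not being a perfect
  square.\<close>

definition zol_nontrivial :: "nat \<Rightarrow> bool" where
  "zol_nontrivial P \<longleftrightarrow> (\<exists>j. coprime j P \<and> zol P j = -1)"

text \<open>The symbol is -1 at the residue -1 if \<open>P\<close> is 7 modulo 8, and at 2 if
  \<open>P\<close> is 3 or 5 modulo 8.\<close>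

lemma zol_nontrivial_mod8:
  assumes "odd P" "P mod 8 \<noteq> 1"
  shows "zol_nontrivial P"
proof (cases "P mod 8 = 7")
  case True
  define h where "h = P div 2"
  have P: "P = Suc (2 * h)" using assms(1) by (simp add: h_def)
  have "odd h" using True unfolding P by presburger
  then have "zol P (2 * h) = -1" using zol_minus_one[of h] by (simp add: P)
  moreover have "coprime (2 * h) P" unfolding P by (rule coprime_Suc_right_nat)
  ultimately show ?thesis unfolding zol_nontrivial_def by blast
next
  case False
  then have "zol P 2 = -1" using assms by (simp add: zol_two_mod8)
  moreover have "coprime 2 P" using assms(1) by simp
  ultimately show ?thesis unfolding zol_nontrivial_def by blast
qed

text \<open>The Chinese remainder theorem extends a witness modulo \<open>a\<close> by the residue 1
  modulo \<open>b\<close>.\<close>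

lemma zol_nontrivial_mult:
  assumes "zol_nontrivial a" "odd a" "odd b" "coprime a b"
  shows "zol_nontrivial (a * b)"
proof -
  obtain j where j: "coprime j a" "zol a j = -1" using assms(1) by (auto simp: zol_nontrivial_def)
  obtain k where k: "[k = j] (mod a)" "[k = 1] (mod b)"
    using binary_chinese_remainder_nat[OF assms(4)] by blast
  have ka: "coprime k a" using k(1) j(1) cong_imp_coprime cong_sym by blast
  have kb: "coprime k b" using cong_imp_coprime[OF cong_sym[OF k(2)]] by simp
  have "zol (a * b) k = zol a k * zol b k" using zol_mult_left assms ka kb by simp
  also have "\<dots> = -1" using zol_cong[OF k(1)] zol_cong[OF k(2)] j(2) by simp
  finally show ?thesis unfolding zol_nontrivial_def using ka kb by (intro exI[of _ k]) simp
qed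

text \<open>A suitable \<open>r\<close> would have symbol -1 modulo each of the three products,
  hence modulo \<open>s * s\<close>, where every symbol is a square and so equals 1.\<close>

lemma not_semi_rational_of_square:
  assumes ABC: "odd_parts n A" "odd_parts n B" "odd_parts n C"
    and nt: "zol_nontrivial (\<Prod>A)" "zol_nontrivial (\<Prod>B)" "zol_nontrivial (\<Prod>C)"
    and sq: "\<Prod>A * \<Prod>B * \<Prod>C = s * s"
  shows "\<not> uniformly_semi_rational (alt_group n)"
proof
  assume "uniformly_semi_rational (alt_group n)"
  then obtain r where r: "\<And>L j. odd_parts n L \<Longrightarrow> coprime j (\<Prod>L) \<Longrightarrow> zol (\<Prod>L) j = -1 \<Longrightarrow>
      coprime r (\<Prod>L) \<and> zol (\<Prod>L) r = -1" by (rule semi_rational_exponent_zol) blast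
  have z: "coprime r (\<Prod>L) \<and> zol (\<Prod>L) r = -1" if "odd_parts n L" "zol_nontrivial (\<Prod>L)" for L
    using r[OF that(1)] that(2) unfolding zol_nontrivial_def by blast
  note rA = z[OF ABC(1) nt(1)] and rB = z[OF ABC(2) nt(2)] and rC = z[OF ABC(3) nt(3)]
  have cop: "coprime r (s * s)" unfolding sq[symmetric] using rA rB rC by simp
  have "odd (\<Prod>A)" "odd (\<Prod>B)" "odd (\<Prod>C)" using odd_parts_prod ABC by blast+
  then have "odd (s * s)" "zol (s * s) r = -1"
    unfolding sq[symmetric] using rA rB rC by (simp_all add: zol_mult_left)
  moreover have "zol (s * s) r = 1" using zol_mult_left[of s s r] \<open>odd (s * s)\<close> cop by simp
  ultimately show False by simp
qed

lemma odd_parts_set: "distinct xs \<Longrightarrow> (\<forall>m\<in>set xs. odd m) \<Longrightarrow> sum_list xs = n \<Longrightarrow> odd_parts n (set xs)"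
  using sum.distinct_set_conv_list[of xs "\<lambda>m. m"] by (simp add: odd_parts_def)

lemma prod_set_distinct: "distinct xs \<Longrightarrow> \<Prod>(set xs) = prod_list xs" for xs :: "nat list"
  using prod.distinct_set_conv_list[of xs "\<lambda>m. m"] by simp

subsection \<open>Square relations between partitions\<close>

text \<open>The number \<open>a\<close> is a unitary divisor of the product of the parts that is visibly not a square.\<close>

definition nonsquare_parts :: "nat \<Rightarrow> nat list \<times> nat \<Rightarrow> bool" where
  "nonsquare_parts n = (\<lambda>(xs, a). distinct xs \<and> (\<forall>m\<in>set xs. odd m) \<and> sum_list xs = n \<and>
    a dvd prod_list xs \<and> gcd a (prod_list xs div a) = 1 \<and> a mod 8 \<noteq> 1)"

definition square_triple ::
  "nat \<times> (nat list \<times> nat) \<times> (nat list \<times> nat) \<times> (nat list \<times> nat) \<times> nat \<Rightarrow> bool" where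
  "square_triple = (\<lambda>(n, A, B, C, s). nonsquare_parts n A \<and> nonsquare_parts n B \<and> nonsquare_parts n C \<and>
    prod_list (fst A) * prod_list (fst B) * prod_list (fst C) = s * s)"

lemma nonsquare_parts_set:
  assumes "nonsquare_parts n A"
  shows "odd_parts n (set (fst A))" "zol_nontrivial (\<Prod>(set (fst A)))"
    "\<Prod>(set (fst A)) = prod_list (fst A)"
proof -
  obtain xs a where A: "A = (xs, a)" by (cases A)
  then have xs: "distinct xs" "\<forall>m\<in>set xs. odd m" "sum_list xs = n" and
    a: "a dvd prod_list xs" "gcd a (prod_list xs div a) = 1" "a mod 8 \<noteq> 1"
    using assms by (auto simp: nonsquare_parts_def)
  show parts: "odd_parts n (set (fst A))" using odd_parts_set[OF xs] by (simp add: A)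
  show prod: "\<Prod>(set (fst A)) = prod_list (fst A)" using prod_set_distinct[OF xs(1)] by (simp add: A)
  have P: "prod_list xs = a * (prod_list xs div a)" using a(1) by simp
  have "odd (prod_list xs)" using odd_parts_prod[OF parts] prod by (simp add: A)
  then have "odd a" "odd (prod_list xs div a)" using P by (metis even_mult_iff)+
  then have "zol_nontrivial (a * (prod_list xs div a))"
    using zol_nontrivial_mult zol_nontrivial_mod8 a(2,3) coprime_iff_gcd_eq_1 by blast
  then show "zol_nontrivial (\<Prod>(set (fst A)))" using P prod by (simp add: A)
qed

lemma not_semi_rational_of_square_triple:
  assumes "square_triple (n, A, B, C, s)"
  shows "\<not> uniformly_semi_rational (alt_group n)"
proof -
  have *: "nonsquare_parts n A" "nonsquare_parts n B" "nonsquare_parts n C"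
    "prod_list (fst A) * prod_list (fst B) * prod_list (fst C) = s * s"
    using assms by (auto simp: square_triple_def)
  show ?thesis
    by (rule not_semi_rational_of_square[OF nonsquare_parts_set(1)[OF *(1)] nonsquare_parts_set(1)[OF *(2)]
          nonsquare_parts_set(1)[OF *(3)] nonsquare_parts_set(2)[OF *(1)]
          nonsquare_parts_set(2)[OF *(2)] nonsquare_parts_set(2)[OF *(3)]])
      (simp only: nonsquare_parts_set(3)[OF *(1)] nonsquare_parts_set(3)[OF *(2)]
          nonsquare_parts_set(3)[OF *(3)] *(4))
qed

text \<open>A table found by computer search; the remaining degrees from 23 on are covered by families.\<close>

definition square_triples ::
  "(nat \<times> (nat list \<times> nat) \<times> (nat list \<times> nat) \<times> (nat list \<times> nat) \<times> nat) list" where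
  "square_triples = [
    (16, ([15, 1], 15), ([9, 7], 63), ([7, 5, 3, 1], 3), 315),
    (21, ([21], 21), ([11, 9, 1], 99), ([11, 7, 3], 231), 693),
    (23, ([15, 7, 1], 3), ([11, 9, 3], 11), ([11, 7, 5], 5), 3465),
    (24, ([21, 3], 63), ([15, 9], 135), ([9, 7, 5, 3], 5), 2835),
    (25, ([21, 3, 1], 63), ([15, 9, 1], 135), ([9, 7, 5, 3, 1], 5), 2835),
    (26, ([21, 5], 3), ([13, 9, 3, 1], 351), ([13, 7, 5, 1], 455), 4095),
    (27, ([21, 5, 1], 3), ([19, 7, 1], 133), ([19, 5, 3], 285), 1995),
    (28, ([27, 1], 27), ([15, 13], 195), ([13, 9, 5, 1], 5), 1755),
    (29, ([25, 3, 1], 75), ([15, 11, 3], 495), ([11, 9, 5, 3, 1], 1485), 7425),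
    (30, ([25, 5], 125), ([21, 5, 3, 1], 315), ([15, 7, 5, 3], 1575), 7875),
    (31, ([17, 13, 1], 221), ([15, 13, 3], 5), ([17, 9, 5], 765), 9945),
    (32, ([27, 5], 135), ([23, 9], 207), ([23, 5, 3, 1], 3), 3105),
    (33, ([33], 3), ([25, 7, 1], 175), ([21, 11, 1], 231), 1155),
    (34, ([21, 13], 3), ([21, 9, 3, 1], 567), ([15, 13, 5, 1], 975), 12285),
    (35, ([27, 7, 1], 189), ([27, 5, 3], 405), ([21, 9, 5], 5), 8505),
    (36, ([35, 1], 35), ([27, 9], 243), ([21, 9, 5, 1], 5), 2835),
    (37, ([21, 15, 1], 315), ([27, 7, 3], 567), ([21, 7, 5, 3, 1], 2205), 19845),
    (39, ([35, 3, 1], 3), ([31, 7, 1], 7), ([31, 5, 3], 3), 3255),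
    (40, ([31, 9], 279), ([25, 15], 375), ([31, 5, 3, 1], 3), 6975),
    (41, ([35, 5, 1], 175), ([25, 15, 1], 375), ([25, 7, 5, 3, 1], 3), 13125),
    (43, ([33, 9, 1], 11), ([35, 5, 3], 525), ([33, 7, 3], 693), 10395),
    (44, ([33, 11], 363), ([29, 15], 435), ([29, 9, 5, 1], 5), 14355),
    (45, ([45], 45), ([33, 11, 1], 363), ([35, 7, 3], 735), 3465),
    (47, ([37, 9, 1], 333), ([25, 21, 1], 525), ([37, 7, 3], 3), 11655),
    (48, ([45, 3], 135), ([39, 9], 351), ([39, 5, 3, 1], 5), 5265),
    (49, ([45, 3, 1], 135), ([33, 9, 7], 2079), ([33, 7, 5, 3, 1], 5), 31185),
    (53, ([37, 15, 1], 555), ([35, 15, 3], 1575), ([37, 7, 5, 3, 1], 3885), 58275),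
    (56, ([47, 9], 423), ([35, 21], 735), ([47, 5, 3, 1], 3), 14805),
    (57, ([57], 3), ([37, 19, 1], 703), ([37, 15, 5], 2775), 10545),
    (64, ([55, 9], 495), ([49, 15], 735), ([55, 5, 3, 1], 3), 17325),
    (65, ([65], 5), ([49, 15, 1], 735), ([39, 25, 1], 975), 6825),
    (72, ([63, 9], 567), ([45, 27], 1215), ([63, 5, 3, 1], 5), 25515),
    (73, ([65, 7, 1], 455), ([57, 13, 3], 2223), ([57, 7, 5, 3, 1], 5), 77805),
    (81, ([77, 3, 1], 231), ([65, 11, 5], 3575), ([65, 7, 5, 3, 1], 3), 75075),
    (89, ([81, 7, 1], 567), ([73, 15, 1], 1095), ([73, 7, 5, 3, 1], 3), 68985)]"

lemma square_triples: "\<forall>c\<in>set square_triples. square_triple c"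
  by (simp add: square_triples_def square_triple_def nonsquare_parts_def gcd_non_0_nat)

lemma not_semi_rational_sporadic:
  assumes "n \<in> fst ` set square_triples"
  shows "\<not> uniformly_semi_rational (alt_group n)"
proof -
  obtain A B C s where "(n, A, B, C, s) \<in> set square_triples"
    using assms by auto
  then show ?thesis using square_triples not_semi_rational_of_square_triple by blast
qed

lemma prod_list_mod: "prod_list xs mod k = prod_list (map (\<lambda>x. x mod k) xs) mod k" for k :: nat
  by (induction xs) (simp_all add: mod_mult_left_eq, metis mod_mult_eq mod_mod_trivial)

text \<open>If the blocks have pairwise distinct products modulo 8, no two of them multiply to a square,
  while the three pairs of blocks together contain every block twice.\<close>

lemma not_semi_rational_of_three_blocks:
  assumes "distinct (U @ V @ W @ D)" "\<forall>m\<in>set (U @ V @ W @ D). odd m"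
    and "sum_list U + sum_list V + sum_list D = n" "sum_list U + sum_list W + sum_list D = n"
      "sum_list V + sum_list W + sum_list D = n"
    and "prod_list D = e * e"
    and "prod_list (map (\<lambda>x. x mod 8) (U @ V @ D)) mod 8 \<noteq> 1"
      "prod_list (map (\<lambda>x. x mod 8) (U @ W @ D)) mod 8 \<noteq> 1"
      "prod_list (map (\<lambda>x. x mod 8) (V @ W @ D)) mod 8 \<noteq> 1"
  shows "\<not> uniformly_semi_rational (alt_group n)"
proof -
  have np: "nonsquare_parts n (xs, prod_list xs)"
    if "distinct xs" "\<forall>m\<in>set xs. odd m" "sum_list xs = n" "prod_list xs mod 8 \<noteq> 1" for xs
  proof -
    have "odd (prod_list xs)" using that(2) by (induction xs) auto
    then have "prod_list xs > 0" by (rule odd_pos)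
    then show ?thesis using that by (simp add: nonsquare_parts_def)
  qed
  \<comment> \<open>Each of \<open>U\<close>, \<open>V\<close>, \<open>W\<close> occurs twice and
    \<open>D\<close> three times; the third \<open>D\<close> supplies the factor \<open>e\<close> of
    the root. As unitary divisor the whole product is taken.\<close>
  have "square_triple (n, (U @ V @ D, prod_list (U @ V @ D)), (U @ W @ D, prod_list (U @ W @ D)),
      (V @ W @ D, prod_list (V @ W @ D)), prod_list U * prod_list V * prod_list W * prod_list D * e)"
    unfolding square_triple_def case_prod_conv
    by (intro conjI np) (use assms[folded prod_list_mod] in \<open>auto simp: algebra_simps\<close>)
  then show ?thesis by (rule not_semi_rational_of_square_triple)
qed

text \<open>One family for each residue modulo 16. Each of the three blocks contains one part
  growing by 8 with \<open>t\<close>, so the degree grows by 16 while the products modulo 8 stay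
  constant. \<open>D\<close> adjusts the degree and has product 1 or 9.\<close>

lemma not_semi_rational_families:
  "\<not> uniformly_semi_rational (alt_group (16 * t + 80))"
  "\<not> uniformly_semi_rational (alt_group (16 * t + 97))"
  "\<not> uniformly_semi_rational (alt_group (16 * t + 50))"
  "\<not> uniformly_semi_rational (alt_group (16 * t + 51))"
  "\<not> uniformly_semi_rational (alt_group (16 * t + 52))"
  "\<not> uniformly_semi_rational (alt_group (16 * t + 69))"
  "\<not> uniformly_semi_rational (alt_group (16 * t + 38))"
  "\<not> uniformly_semi_rational (alt_group (16 * t + 55))"
  "\<not> uniformly_semi_rational (alt_group (16 * t + 88))"
  "\<not> uniformly_semi_rational (alt_group (16 * t + 105))"
  "\<not> uniformly_semi_rational (alt_group (16 * t + 42))"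
  "\<not> uniformly_semi_rational (alt_group (16 * t + 59))"
  "\<not> uniformly_semi_rational (alt_group (16 * t + 60))"
  "\<not> uniformly_semi_rational (alt_group (16 * t + 61))"
  "\<not> uniformly_semi_rational (alt_group (16 * t + 46))"
  "\<not> uniformly_semi_rational (alt_group (16 * t + 63))"
  subgoal by (rule not_semi_rational_of_three_blocks[of "[8 * t + 35]" "[8 * t + 25, 3, 7]"
        "[8 * t + 17, 5, 13]" "[1, 9]" _ 3])
      simp_all
  subgoal by (rule not_semi_rational_of_three_blocks[of "[8 * t + 39, 9]" "[8 * t + 23, 3, 7, 15]"
        "[8 * t + 19, 5, 11, 13]" "[1]" _ 1])
      simp_all
  subgoal by (rule not_semi_rational_of_three_blocks[of "[8 * t + 25]" "[8 * t + 19, 1, 5]"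
        "[8 * t + 15, 3, 7]" "[]" _ 1])
      simp_all
  subgoal by (rule not_semi_rational_of_three_blocks[of "[8 * t + 25]" "[8 * t + 15, 3, 7]"
        "[8 * t + 11, 5, 9]" "[1]" _ 1])
      simp_all
  subgoal by (rule not_semi_rational_of_three_blocks[of "[8 * t + 23, 3]" "[8 * t + 17, 9]"
        "[8 * t + 13, 1, 5, 7]" "[]" _ 1])
      simp_all
  subgoal by (rule not_semi_rational_of_three_blocks[of "[8 * t + 29, 5]" "[8 * t + 23, 11]"
        "[8 * t + 15, 3, 7, 9]" "[1]" _ 1])
      simp_all
  subgoal by (rule not_semi_rational_of_three_blocks[of "[8 * t + 19]" "[8 * t + 13, 1, 5]"
        "[8 * t + 9, 3, 7]" "[]" _ 1])
      simp_all
  subgoal by (rule not_semi_rational_of_three_blocks[of "[8 * t + 27]" "[8 * t + 17, 3, 7]"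
        "[8 * t + 13, 5, 9]" "[1]" _ 1])
      simp_all
  subgoal by (rule not_semi_rational_of_three_blocks[of "[8 * t + 39]" "[8 * t + 29, 3, 7]"
        "[8 * t + 21, 5, 13]" "[1, 9]" _ 3])
      simp_all
  subgoal by (rule not_semi_rational_of_three_blocks[of "[8 * t + 47, 5]" "[8 * t + 27, 3, 7, 15]"
        "[8 * t + 19, 9, 11, 13]" "[1]" _ 1])
      simp_all
  subgoal by (rule not_semi_rational_of_three_blocks[of "[8 * t + 21]" "[8 * t + 15, 1, 5]"
        "[8 * t + 11, 3, 7]" "[]" _ 1])
      simp_all
  subgoal by (rule not_semi_rational_of_three_blocks[of "[8 * t + 29]" "[8 * t + 19, 3, 7]"
        "[8 * t + 15, 5, 9]" "[1]" _ 1])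
      simp_all
  subgoal by (rule not_semi_rational_of_three_blocks[of "[8 * t + 29, 1]" "[8 * t + 23, 7]"
        "[8 * t + 13, 3, 5, 9]" "[]" _ 1])
      simp_all
  subgoal by (rule not_semi_rational_of_three_blocks[of "[8 * t + 21, 9]" "[8 * t + 19, 11]"
        "[8 * t + 15, 3, 5, 7]" "[1]" _ 1])
      simp_all
  subgoal by (rule not_semi_rational_of_three_blocks[of "[8 * t + 23]" "[8 * t + 17, 1, 5]"
        "[8 * t + 13, 3, 7]" "[]" _ 1])
      simp_all
  subgoal by (rule not_semi_rational_of_three_blocks[of "[8 * t + 31]" "[8 * t + 21, 3, 7]"
        "[8 * t + 17, 5, 9]" "[1]" _ 1])
      simp_all
  done

lemma not_semi_rational_large:
  assumes "23 \<le> n"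
  shows "\<not> uniformly_semi_rational (alt_group n)"
proof (cases "n \<in> fst ` set square_triples")
  case False
  \<comment> \<open>105 is the largest starting degree of a family; from there on the families cover
    every residue modulo 16.\<close>
  have small: "\<forall>n\<in>set [23..<105]. n \<in> fst ` set square_triples \<or>
      (\<exists>k\<in>{38, 42, 46, 50, 51, 52, 55, 59, 60, 61, 63, 69, 80, 88, 97, 105}. k \<le> n \<and> n mod 16 = k mod 16)"
    by (simp add: square_triples_def)
  have "\<exists>k\<in>{38, 42, 46, 50, 51, 52, 55, 59, 60, 61, 63, 69, 80, 88, 97, 105}. k \<le> n \<and> n mod 16 = k mod 16"
  proof (cases "n < 105")
    case True
    then show ?thesis using small False assms by (metis atLeastLessThan_iff set_upt)
  next
    case 105: False
    have "\<exists>k\<in>{38, 42, 46, 50, 51, 52, 55, 59, 60, 61, 63, 69, 80, 88, 97, 105}. k \<le> 105 \<and> n mod 16 = k mod 16"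
      by (simp, presburger)
    then show ?thesis using 105 by (meson le_trans linorder_not_less)
  qed
  then obtain k where k: "k \<in> {38, 42, 46, 50, 51, 52, 55, 59, 60, 61, 63, 69, 80, 88, 97, 105}" "k \<le> n" "n mod 16 = k mod 16" by blast
  have "16 dvd n - k" using mod_eq_dvd_iff_nat[OF k(2), of 16] k(3) by simp
  then obtain t where "n - k = 16 * t" ..
  then have "n = 16 * t + k" using k(2) by simp
  then show ?thesis using k(1) not_semi_rational_families[of t] by (elim insertE emptyE) simp_all
qed (rule not_semi_rational_sporadic)

subsection \<open>Small degrees\<close>

text \<open>Since 17 is 1 modulo 8, neither -1 nor 2 has symbol -1 there. But 3 is a primitive root,
  so multiplication by 3 is a single cycle on the 16 nonzero residues, written as 15
  transpositions.\<close>

lemma zol_17_3: "zol 17 3 = -1"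
proof -
  let ?ts = "[(1, 3), (3, 9), (9, 10), (10, 13), (13, 5), (5, 15), (15, 11), (11, 16), (16, 14),
    (14, 8), (8, 7), (7, 4), (4, 12), (12, 2), (2, 6)] :: (nat \<times> nat) list"
  have "mulmap 17 3 i = apply_transps ?ts i" for i
  proof (cases "i < 17")
    case True
    then have "i \<in> {0, 1, 2, 3, 4, 5, 6, 7, 8, 9, 10, 11, 12, 13, 14, 15, 16}"
      by (simp, presburger)
    then show ?thesis
      by (elim insertE emptyE) (simp_all add: mulmap_def transpose_def)
  next
    case False
    then show ?thesis by (simp add: mulmap_def transpose_def)
  qed
  then have "mulmap 17 3 = apply_transps ?ts" by (rule ext)
  moreover have "evenperm (apply_transps ?ts) \<longleftrightarrow> even (length ?ts)"
    by (rule evenperm_apply_transps_iff) simp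
  ultimately show ?thesis by (simp add: zol_def sign_def del: apply_transps_Cons)
qed

text \<open>Computable by rewriting, so that \<open>simp\<close> can go through all partitions of a
  small degree. The order of the base list is kept, so each set of parts appears in decreasing order
  below.\<close>

fun part_lists :: "nat list \<Rightarrow> nat \<Rightarrow> nat list list" where
  "part_lists [] n = (if n = 0 then [[]] else [])"
| "part_lists (b # bs) n =
    part_lists bs n @ (if b \<le> n then map (Cons b) (part_lists bs (n - b)) else [])"

lemma part_lists_complete:
  assumes "distinct bs" "L \<subseteq> set bs" "\<Sum>L = n"
  shows "\<exists>xs\<in>set (part_lists bs n). distinct xs \<and> set xs = L"
  using assms
proof (induction bs arbitrary: L n)
  case (Cons b bs)
  have fin: "finite L" using Cons.prems(2) by (rule finite_subset) simp
  show ?case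
  proof (cases "b \<in> L")
    case True
    then have sum: "b + \<Sum>(L - {b}) = n" using Cons.prems(3) fin by (simp add: sum.remove[of L b])
    have "L - {b} \<subseteq> set bs" "distinct bs" using Cons.prems by auto
    from Cons.IH[OF this(2,1), of "n - b"] sum
    obtain xs where "xs \<in> set (part_lists bs (n - b))" "distinct xs" "set xs = L - {b}" by auto
    then show ?thesis using sum True by (intro bexI[of _ "b # xs"]) auto
  next
    case False
    then have "L \<subseteq> set bs" "distinct bs" using Cons.prems by auto
    from Cons.IH[OF this(2,1) Cons.prems(3)] show ?thesis by auto
  qed
qed auto

text \<open>14549535 is the least common multiple of the odd numbers up to 21. The three exempt
  lists have the square products 1 and 9, for which the symbol is trivial.\<close>

lemma semi_rational_small:
  assumes n: "n \<le> 22" and r: "coprime r 14549535"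
    and z: "\<forall>xs\<in>set (part_lists [21, 19, 17, 15, 13, 11, 9, 7, 5, 3, 1] n).
      xs \<in> {[1], [9], [9, 1]} \<or> prod_list (map (\<lambda>m. zol m r) xs) = -1"
  shows "uniformly_semi_rational (alt_group n)"
proof (rule semi_rational_if_zol)
  fix L assume L: "odd_parts n L"
  define bs :: "nat list" where "bs = [21, 19, 17, 15, 13, 11, 9, 7, 5, 3, 1]"
  have fin: "finite L" and odd: "\<forall>m\<in>L. odd m" and sum: "\<Sum>L = n"
    using L by (auto simp: odd_parts_def)
  have dist: "distinct bs" by (simp add: bs_def)
  have sub: "L \<subseteq> set bs"
  proof
    fix m assume "m \<in> L"
    then have "m \<le> 22" "odd m" using member_le_sum[of m L "\<lambda>m. m"] fin sum n odd by auto
    then show "m \<in> set bs" unfolding bs_def by (simp, presburger)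
  qed
  obtain xs where xs: "xs \<in> set (part_lists bs n)" "distinct xs" "set xs = L"
    using part_lists_complete[OF dist sub sum] by blast
  have prod: "prod_list (map f xs) = (\<Prod>m\<in>L. f m)" for f :: "nat \<Rightarrow> int"
    using prod.distinct_set_conv_list[OF xs(2), of f] unfolding xs(3) by (rule sym)
  have z9: "zol 9 j = 1" if "coprime j 9" for j
  proof -
    have "zol (3 * 3) j = zol 3 j * zol 3 j"
      by (rule zol_mult_left) (use that in simp_all)
    then show ?thesis by simp
  qed
  have "\<Prod>L \<in> {1, 9}" if "xs \<in> {[1], [9], [9, 1]}"
    using that xs(3) by auto
  then have triv: "\<forall>j. coprime j (\<Prod>L) \<longrightarrow> zol (\<Prod>L) j = 1" if "xs \<in> {[1], [9], [9, 1]}"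
    using that z9 by (metis insertE singletonD One_nat_def zol_one_left)
  have "coprime r m" if "m \<in> L" for m
  proof -
    have "m dvd 14549535" using that sub by (auto simp: bs_def)
    then show ?thesis using r by (rule coprime_divisors[OF dvd_refl])
  qed
  then have cop: "coprime r (\<Prod>L)" using coprime_prod_nat[OF fin] by blast
  show "(coprime r (\<Prod>L) \<and> zol (\<Prod>L) r = -1) \<or> (\<forall>j. coprime j (\<Prod>L) \<longrightarrow> zol (\<Prod>L) j = 1)"
  proof (cases "xs \<in> {[1], [9], [9, 1]}")
    case True
    then show ?thesis using triv by blast
  next
    case False
    then have "prod_list (map (\<lambda>m. zol m r) xs) = -1" using z xs(1) unfolding bs_def by blast
    then have "zol (\<Prod>L) r = -1" unfolding zol_prod[OF fin odd cop] prod .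
    then show ?thesis using cop by blast
  qed
qed

lemma zol_mod: "zol m j = zol m (j mod m)"
  by (rule zol_cong) (simp add: cong_def)

text \<open>Reduces the composite parts to primes, so that the exponents below need only be
  evaluated at 3, 5, 7, 11, 13, 17 and 19.\<close>

lemma zol_composite:
  assumes "coprime r 14549535"
  shows "zol 9 r = 1" "zol 15 r = zol 3 r * zol 5 r" "zol 21 r = zol 3 r * zol 7 r"
proof -
  have "coprime r 9" "coprime r 15" "coprime r 21"
    by (rule coprime_divisors[OF dvd_refl _ assms], simp)+
  then show "zol 9 r = 1" "zol 15 r = zol 3 r * zol 5 r" "zol 21 r = zol 3 r * zol 7 r"
    using zol_mult_left[of 3 3 r] zol_mult_left[of 3 5 r] zol_mult_left[of 3 7 r] by simp_all
qed

text \<open>The exponent 2 works in most cases; the other ones come from the Chinese remainder theorem,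
  by prescribing the symbols at the primes up to 19.\<close>

lemma semi_rational_exponent_2:
  assumes "n \<in> {1, 2, 3, 4, 5, 6, 10, 11, 12, 13, 20}"
  shows "uniformly_semi_rational (alt_group n)"
proof -
  have cop: "coprime 2 (14549535 :: nat)"
    by (simp add: coprime_iff_gcd_eq_1 gcd_non_0_nat)
  have z: "zol 3 2 = -1" "zol 5 2 = -1" "zol 7 2 = 1" "zol 11 2 = -1" "zol 13 2 = -1" "zol 17 2 = 1" "zol 19 2 = -1"
    by (simp_all add: zol_two_mod8)
  show ?thesis
    using assms
    by (elim insertE emptyE; hypsubst; intro semi_rational_small[OF _ cop];
        simp add: z zol_composite[OF cop])
qed

lemma semi_rational_exponent_149722:
  assumes "n \<in> {7, 8, 9, 18, 19}"
  shows "uniformly_semi_rational (alt_group n)"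
proof -
  have cop: "coprime 149722 (14549535 :: nat)"
    by (simp add: coprime_iff_gcd_eq_1 gcd_non_0_nat)
  \<comment> \<open>The exponent is 1 modulo the primes where the symbol is to be 1, and 2 where it
    is to be -1, except that 6 is used modulo 7 and 3 modulo 17, because 2 is a square there. The
    later exponents follow the same scheme.\<close>
  have z: "zol 3 149722 = 1" "zol 5 149722 = -1" "zol 7 149722 = -1" "zol 11 149722 = 1" "zol 13 149722 = 1" "zol 17 149722 = -1" "zol 19 149722 = -1"
    using zol_17_3 zol_minus_one[of 3]
    by (simp_all add: zol_mod[of _ 149722] zol_two_mod8)
  show ?thesis
    using assms
    by (elim insertE emptyE; hypsubst; intro semi_rational_small[OF _ cop];
        simp add: z zol_composite[OF cop])
qed

lemma semi_rational_exponent_4083367: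
  assumes "n \<in> {14, 15}"
  shows "uniformly_semi_rational (alt_group n)"
proof -
  have cop: "coprime 4083367 (14549535 :: nat)"
    by (simp add: coprime_iff_gcd_eq_1 gcd_non_0_nat)
  have z: "zol 3 4083367 = 1" "zol 5 4083367 = -1" "zol 7 4083367 = 1" "zol 11 4083367 = -1" "zol 13 4083367 = -1" "zol 17 4083367 = 1" "zol 19 4083367 = 1"
    using zol_17_3 zol_minus_one[of 3]
    by (simp_all add: zol_mod[of _ 4083367] zol_two_mod8)
  show ?thesis
    using assms
    by (elim insertE emptyE; hypsubst; intro semi_rational_small[OF _ cop];
        simp add: z zol_composite[OF cop])
qed

lemma semi_rational_exponent_496:
  assumes "n \<in> {22}"
  shows "uniformly_semi_rational (alt_group n)"
proof -
  have cop: "coprime 496 (14549535 :: nat)"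
    by (simp add: coprime_iff_gcd_eq_1 gcd_non_0_nat)
  have z: "zol 3 496 = 1" "zol 5 496 = 1" "zol 7 496 = -1" "zol 11 496 = 1" "zol 13 496 = -1" "zol 17 496 = -1" "zol 19 496 = -1"
    using zol_17_3 zol_minus_one[of 3]
    by (simp_all add: zol_mod[of _ 496] zol_two_mod8)
  show ?thesis
    using assms
    by (elim insertE emptyE; hypsubst; intro semi_rational_small[OF _ cop];
        simp add: z zol_composite[OF cop])
qed

lemma semi_rational_exponent_4390882:
  assumes "n \<in> {17}"
  shows "uniformly_semi_rational (alt_group n)"
proof -
  have cop: "coprime 4390882 (14549535 :: nat)"
    by (simp add: coprime_iff_gcd_eq_1 gcd_non_0_nat)
  have z: "zol 3 4390882 = 1" "zol 5 4390882 = -1" "zol 7 4390882 = -1" "zol 11 4390882 = 1" "zol 13 4390882 = -1" "zol 17 4390882 = -1" "zol 19 4390882 = 1"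
    using zol_17_3 zol_minus_one[of 3]
    by (simp_all add: zol_mod[of _ 4390882] zol_two_mod8)
  show ?thesis
    using assms
    by (elim insertE emptyE; hypsubst; intro semi_rational_small[OF _ cop];
        simp add: z zol_composite[OF cop])
qed

lemma semi_rational_le_22:
  assumes "0 < n" "n < 23" "n \<notin> {16, 21}"
  shows "uniformly_semi_rational (alt_group n)"
proof -
  have "n \<in> {1, 2, 3, 4, 5, 6, 10, 11, 12, 13, 20} \<or> n \<in> {7, 8, 9, 18, 19} \<or> n \<in> {14, 15} \<or>
      n \<in> {22} \<or> n \<in> {17}"
    using assms by (simp, presburger)
  then show ?thesis
    by (elim disjE) (erule semi_rational_exponent_2 semi_rational_exponent_149722 semi_rational_exponent_4083367 semi_rational_exponent_496 semi_rational_exponent_4390882)+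
qed

theorem theoremA:
  fixes n :: nat
  assumes "n > 0"
  shows "uniformly_semi_rational (alt_group n) \<longleftrightarrow> n < 23 \<and> n \<notin> {16, 21}"
proof
  assume usr: "uniformly_semi_rational (alt_group n)"
  have "n < 23" using not_semi_rational_large usr by (metis not_less)
  moreover have "\<not> uniformly_semi_rational (alt_group 16)" "\<not> uniformly_semi_rational (alt_group 21)"
    by (rule not_semi_rational_sporadic, simp add: square_triples_def)+
  ultimately show "n < 23 \<and> n \<notin> {16, 21}" using usr by auto
next
  assume "n < 23 \<and> n \<notin> {16, 21}"
  then show "uniformly_semi_rational (alt_group n)" using semi_rational_le_22 assms by blast
qed

end
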